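(* \textsc{$\alpha$-Globally Optimal Assignment} admits a kernel of size $\mathcal{O}(\ell n^{2})$: there is a polynomial-time algorithm that, given an instance with $n$ agents and $\ell$ layers, outputs an equivalent instance of \textsc{$\alpha$-Globally Optimal Assignment} (a yes-instance iff the original is) whose size is $\mathcal{O}(\ell n^2)$. In particular, the problem admits a polynomial kernel with respect to the parameter $n+\ell$.
   Context: An instance of \textsc{$\alpha$-Globally Optimal Assignment} is a tuple $(A,I,P_1,\ldots,P_\ell,\alpha)$ where $A$ is a set of $n$ agents, $I$ is a set of $m$ items, $\alpha\in\{1,\ldots,\ell\}$, and for each layer $j\in\{1,\ldots,\ell\}$ the preference profile $P_j$ assigns to every agent $a$ a preference list $<^{(j)}_a$, which is a strict linear order over a subset of $I$ (the items acceptable to $a$ in layer $j$; lists may be incomplete). A special item $b_\emptyset\notin I$ is regarded as the least preferred item of every agent. An assignment is a map $p:A\to I\cup\{b_\emptyset\}$ such that no item of $I$ is assigned to two different agents; it is legal in layer $j$ if every agent receives either $b_\emptyset$ or an item acceptable to it in layer $j$. A legal assignment $p$ is Pareto optimal in layer $j$ if there is no other legal assignment $q$ (for layer $j$) with $p(a)\le^{(j)}_a q(a)$ for all $a\in A$ and $p(a)<^{(j)}_a q(a)$ for some $a\in A$. An assignment is $\alpha$-globally optimal if there exist $\alpha$ distinct layers in each of which it is Pareto optimal. The problem asks whether an $\alpha$-globally optimal assignment exists. *)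

theory Defs
  imports Main "HOL-Computational_Algebra.Polynomial"
begin

section \<open>Assignments under preference lists\<close>

text \<open>
  A strict linear order over a subset of the items is a distinct list, most preferred item first.
  The value \<open>None\<close> is the special item that is less preferred than every listed item.
  Assignments are only inspected on the given set of agents.
\<close>

definition pref_less :: "'b list \<Rightarrow> 'b option \<Rightarrow> 'b option \<Rightarrow> bool" where
  "pref_less L x y \<longleftrightarrow>
     (\<exists>i<length L. y = Some (L ! i) \<and> (x = None \<or> (\<exists>k<length L. i < k \<and> x = Some (L ! k))))"

definition pref_le :: "'b list \<Rightarrow> 'b option \<Rightarrow> 'b option \<Rightarrow> bool" where
  "pref_le L x y \<longleftrightarrow> x = y \<or> pref_less L x y"

definition assignment :: "'a set \<Rightarrow> 'b set \<Rightarrow> ('a \<Rightarrow> 'b option) \<Rightarrow> bool" where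
  "assignment A I p \<longleftrightarrow>
     (\<forall>a\<in>A. \<forall>b. p a = Some b \<longrightarrow> b \<in> I) \<and>
     (\<forall>a\<in>A. \<forall>a'\<in>A. \<forall>b. p a = Some b \<and> p a' = Some b \<longrightarrow> a = a')"

definition legal :: "'a set \<Rightarrow> 'b set \<Rightarrow> ('a \<Rightarrow> 'b list) \<Rightarrow> ('a \<Rightarrow> 'b option) \<Rightarrow> bool" where
  "legal A I P p \<longleftrightarrow>
     assignment A I p \<and> (\<forall>a\<in>A. p a = None \<or> (\<exists>b\<in>set (P a). p a = Some b))"

definition pareto_optimal :: "'a set \<Rightarrow> 'b set \<Rightarrow> ('a \<Rightarrow> 'b list) \<Rightarrow> ('a \<Rightarrow> 'b option) \<Rightarrow> bool" where
  "pareto_optimal A I P p \<longleftrightarrow>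
     legal A I P p \<and>
     \<not> (\<exists>q. legal A I P q \<and> (\<forall>a\<in>A. pref_le (P a) (p a) (q a)) \<and>
            (\<exists>a\<in>A. pref_less (P a) (p a) (q a)))"


section \<open>The problem \<open>\<alpha>\<close>-Globally Optimal Assignment\<close>

text \<open>
  Agents, items and layers are numbered from 0. The entry \<open>prefs G ! j ! a\<close> is the preference
  list of agent \<open>a\<close> in layer \<open>j\<close>.
\<close>

record goa =
  num_agents :: nat
  num_items :: nat
  prefs :: "nat list list list"
  alpha :: nat

definition agents :: "goa \<Rightarrow> nat set" where
  "agents G = {..<num_agents G}"

definition items :: "goa \<Rightarrow> nat set" where
  "items G = {..<num_items G}"

definition num_layers :: "goa \<Rightarrow> nat" where
  "num_layers G = length (prefs G)"

definition goa_instance :: "goa \<Rightarrow> bool" where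
  "goa_instance G \<longleftrightarrow>
     1 \<le> alpha G \<and> alpha G \<le> num_layers G \<and>
     (\<forall>P\<in>set (prefs G). length P = num_agents G \<and> (\<forall>L\<in>set P. distinct L \<and> set L \<subseteq> items G))"

definition globally_optimal :: "goa \<Rightarrow> (nat \<Rightarrow> nat option) \<Rightarrow> bool" where
  "globally_optimal G p \<longleftrightarrow>
     assignment (agents G) (items G) p \<and>
     (\<exists>S\<subseteq>{..<num_layers G}. card S = alpha G \<and>
        (\<forall>j\<in>S. pareto_optimal (agents G) (items G) (\<lambda>a. prefs G ! j ! a) p))"

definition goa_yes :: "goa \<Rightarrow> bool" where
  "goa_yes G \<longleftrightarrow> (\<exists>p. globally_optimal G p)"

text \<open>
  The size of an instance in the usual unit-cost sense: an entry of a preference list, which names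
  one of the \<open>num_items G\<close> items, counts as one. Every list and every layer, even an empty one,
  contributes at least one.
\<close>

definition goa_size :: "goa \<Rightarrow> nat" where
  "goa_size G = num_agents G + num_items G + alpha G +
     (\<Sum>P\<leftarrow>prefs G. 1 + (\<Sum>L\<leftarrow>P. 1 + length L))"


section \<open>Polynomial-time computation\<close>

text \<open>
  The model is the language WHILE over binary trees of N. Jones (Computability and Complexity from
  a Programming Perspective). Instead of one step per operation, every evaluated subexpression is
  charged the size of its value. Sharing therefore cannot hide large intermediate values, and the
  cost is polynomially related to the running time of a Turing machine.
\<close>

datatype tree = Leaf | Node tree tree

fun tree_size :: "tree \<Rightarrow> nat" where
  "tree_size Leaf = 1"
| "tree_size (Node l r) = 1 + tree_size l + tree_size r"

fun left :: "tree \<Rightarrow> tree" where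
  "left Leaf = Leaf"
| "left (Node l r) = l"

fun right :: "tree \<Rightarrow> tree" where
  "right Leaf = Leaf"
| "right (Node l r) = r"

datatype expr = Var nat | Const tree | Cons expr expr | Hd expr | Tl expr | Eq expr expr

type_synonym state = "nat \<Rightarrow> tree"

fun eval :: "expr \<Rightarrow> state \<Rightarrow> tree" where
  "eval (Var x) s = s x"
| "eval (Const t) s = t"
| "eval (Cons e f) s = Node (eval e s) (eval f s)"
| "eval (Hd e) s = left (eval e s)"
| "eval (Tl e) s = right (eval e s)"
| "eval (Eq e f) s = (if eval e s = eval f s then Node Leaf Leaf else Leaf)"

fun cost :: "expr \<Rightarrow> state \<Rightarrow> nat" where
  "cost (Var x) s = tree_size (eval (Var x) s)"
| "cost (Const t) s = tree_size (eval (Const t) s)"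
| "cost (Cons e f) s = cost e s + cost f s + tree_size (eval (Cons e f) s)"
| "cost (Hd e) s = cost e s + tree_size (eval (Hd e) s)"
| "cost (Tl e) s = cost e s + tree_size (eval (Tl e) s)"
| "cost (Eq e f) s = cost e s + cost f s + tree_size (eval (Eq e f) s)"

datatype com = Skip | Assign nat expr | Seq com com | If expr com com | While expr com

text \<open>
  \<open>exec c s t s'\<close>: started in \<open>s\<close>, the command \<open>c\<close> terminates in \<open>s'\<close> at total cost \<open>t\<close>.
  A test succeeds iff its value is not \<open>Leaf\<close>.
\<close>

inductive exec :: "com \<Rightarrow> state \<Rightarrow> nat \<Rightarrow> state \<Rightarrow> bool" where
  Skip: "exec Skip s 1 s"
| Assign: "exec (Assign x e) s (cost e s) (s(x := eval e s))"
| Seq: "exec c s t s' \<Longrightarrow> exec d s' u s'' \<Longrightarrow> exec (Seq c d) s (t + u) s''"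
| IfTrue: "eval e s \<noteq> Leaf \<Longrightarrow> exec c s t s' \<Longrightarrow> exec (If e c d) s (cost e s + t) s'"
| IfFalse: "eval e s = Leaf \<Longrightarrow> exec d s t s' \<Longrightarrow> exec (If e c d) s (cost e s + t) s'"
| WhileFalse: "eval e s = Leaf \<Longrightarrow> exec (While e c) s (cost e s) s"
| WhileTrue: "eval e s \<noteq> Leaf \<Longrightarrow> exec c s t s' \<Longrightarrow> exec (While e c) s' u s'' \<Longrightarrow>
    exec (While e c) s (cost e s + t + u) s''"

lemma exec_deterministic:
  "exec c s t s' \<Longrightarrow> exec c s u s'' \<Longrightarrow> t = u \<and> s' = s''"
proof (induction arbitrary: u s'' rule: exec.induct)
  case (Skip s)
  then show ?case by (auto elim: exec.cases)
next
  case (Assign x e s)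
  then show ?case by (auto elim: exec.cases)
next
  case (Seq c s t s' d u' s1)
  from Seq.prems show ?case by cases (use Seq.IH in blast)
next
  case (IfTrue e s c t s' d)
  from IfTrue.prems show ?case by cases (use IfTrue in blast)+
next
  case (IfFalse e s d t s' c)
  from IfFalse.prems show ?case by cases (use IfFalse in blast)+
next
  case (WhileFalse e s c)
  from WhileFalse.prems show ?case by cases (use WhileFalse in blast)+
next
  case (WhileTrue e s c t s' u' s1)
  from WhileTrue.prems show ?case by cases (use WhileTrue in blast)+
qed

text \<open>Input and output are passed in variable 0; all other variables initially hold \<open>Leaf\<close>.\<close>

definition poly_time_on :: "'i set \<Rightarrow> ('i \<Rightarrow> tree) \<Rightarrow> ('o \<Rightarrow> tree) \<Rightarrow> ('i \<Rightarrow> 'o) \<Rightarrow> bool" where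
  "poly_time_on D enc_in enc_out f \<longleftrightarrow>
     (\<exists>c. \<exists>b :: nat poly. \<forall>x\<in>D. \<exists>t s.
        exec c ((\<lambda>_. Leaf)(0 := enc_in x)) t s \<and>
        s 0 = enc_out (f x) \<and> t \<le> poly b (tree_size (enc_in x)))"


section \<open>Encoding of instances\<close>

text \<open>
  Numbers are written in unary. Since \<open>\<alpha>\<close> is at most the number of layers and the item set is part
  of the input, the length of the encoding is still polynomial in \<open>goa_size\<close>.
\<close>

fun enc_list :: "('a \<Rightarrow> tree) \<Rightarrow> 'a list \<Rightarrow> tree" where
  "enc_list f [] = Leaf"
| "enc_list f (x # xs) = Node (f x) (enc_list f xs)"

definition enc_nat :: "nat \<Rightarrow> tree" where
  "enc_nat k = enc_list (\<lambda>_. Leaf) (replicate k ())"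

definition enc_goa :: "goa \<Rightarrow> tree" where
  "enc_goa G = Node (enc_nat (num_agents G)) (Node (enc_nat (num_items G))
     (Node (enc_nat (alpha G)) (enc_list (enc_list (enc_list enc_nat)) (prefs G))))"

lemma inj_enc_list:
  assumes "inj f"
  shows "inj (enc_list f)"
proof (rule injI)
  fix xs ys assume "enc_list f xs = enc_list f ys"
  then show "xs = ys"
  proof (induction xs arbitrary: ys)
    case Nil
    then show ?case by (cases ys) auto
  next
    case (Cons x xs)
    then show ?case using assms by (cases ys) (auto dest: injD)
  qed
qed

lemma inj_enc_nat: "inj enc_nat"
proof (rule injI)
  fix j k assume "enc_nat j = enc_nat k"
  then have "replicate j () = replicate k ()"
    unfolding enc_nat_def by (rule inj_enc_list[THEN injD, rotated]) (simp add: inj_def)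
  then show "j = k" by (metis length_replicate)
qed

lemma inj_enc_goa: "inj enc_goa"
proof (rule injI)
  fix G H assume "enc_goa G = enc_goa H"
  then show "G = H"
    using inj_enc_nat inj_enc_list[OF inj_enc_list[OF inj_enc_list[OF inj_enc_nat]]]
    by (auto simp: enc_goa_def dest: injD intro: goa.equality)
qed


section \<open>Kernels\<close>

definition goa_kernelization :: "(goa \<Rightarrow> goa) \<Rightarrow> bool" where
  "goa_kernelization K \<longleftrightarrow>
     poly_time_on {G. goa_instance G} enc_goa enc_goa K \<and>
     (\<forall>G. goa_instance G \<longrightarrow> goa_instance (K G) \<and> (goa_yes (K G) \<longleftrightarrow> goa_yes G))"

text \<open>
  Kernel of size \<open>O(g)\<close>. The additive constant only matters where \<open>g\<close> vanishes; no instance has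
  size 0.
\<close>

definition goa_kernel_of_size :: "(goa \<Rightarrow> nat) \<Rightarrow> bool" where
  "goa_kernel_of_size g \<longleftrightarrow>
     (\<exists>K C. goa_kernelization K \<and> (\<forall>G. goa_instance G \<longrightarrow> goa_size (K G) \<le> C * g G + C))"

text \<open>
  A polynomial kernel for the parameter \<open>\<kappa>\<close> bounds both the length of the encoded output and its
  parameter by a polynomial in \<open>\<kappa>\<close>.
\<close>

definition goa_polynomial_kernel :: "(goa \<Rightarrow> nat) \<Rightarrow> bool" where
  "goa_polynomial_kernel \<kappa> \<longleftrightarrow>
     (\<exists>K. \<exists>b :: nat poly. goa_kernelization K \<and>
        (\<forall>G. goa_instance G \<longrightarrow>
           tree_size (enc_goa (K G)) \<le> poly b (\<kappa> G) \<and> \<kappa> (K G) \<le> poly b (\<kappa> G)))"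

end

theory Submission
  imports Defs
begin

text \<open>
  With \<open>n\<close> agents, a Pareto optimal assignment never gives an agent an item outside the top \<open>n\<close> of its
  list: the other agents hold at most \<open>n - 1\<close> items, so one of the top \<open>n\<close> items would be free. For the
  same reason, an assignment that is optimal for the lists truncated to length \<open>n\<close> cannot be
  improved with the full lists. At most \<open>\<ell>n\<^sup>2\<close> items remain after truncation, and renaming
  them injectively does not affect optimality.
\<close>

section \<open>Truncating and renaming preference lists\<close>

text \<open>Truncation alone does not bound the item set or the item numbers, and numbers are
  written in unary. Renaming an item to a position among the at most l n^2 retained entries, with l
  layers, bounds both. The two claims use different measures: \<open>goa_size\<close> charges 1 per
  entry, which gives O(l n^2), whereas the encoded length also pays for the unary value of each
  entry and is only shown to be polynomial in n + l.

  The longer half of the proof is the running time. Since \<open>exec\<close> charges the sizes of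
  values, every loop would call for its own growth estimate. Instead, one number M bounds all
  variables at all loop boundaries, each program is shown to take time polynomial in M, and M is
  chosen only at the end. For an input of size N, truncation does not enlarge the encoding and
  renaming enlarges it at most by the factor N, so M = N^2 suffices.\<close>

lemma pref_lessI:
  assumes "i < length L" "y = Some (L ! i)"
    "x = None \<or> (\<exists>k<length L. i < k \<and> x = Some (L ! k))"
  shows "pref_less L x y"
  using assms by (auto simp only: pref_less_def)

lemma pref_lessE:
  assumes "pref_less L x y"
  obtains i where "i < length L" "y = Some (L ! i)"
    "x = None \<or> (\<exists>k<length L. i < k \<and> x = Some (L ! k))"
  using assms by (auto simp only: pref_less_def)

lemma pref_less_take:
  assumes "pref_less (take n L) x y"
  shows "pref_less L x y"
  using assms by (rule pref_lessE) (rule pref_lessI, auto)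

lemma pref_le_take: "pref_le (take n L) x y \<Longrightarrow> pref_le L x y"
  using pref_less_take by (auto simp: pref_le_def)

text \<open>Distinctness gives an item a single position, so an item of \<open>take n L\<close> has
  an index below \<open>n\<close> in \<open>L\<close>. Restricting both values to the top is what
  makes the converse of \<open>pref_less_take\<close> true.\<close>

lemma pref_less_take_iff:
  assumes "distinct L" "y \<in> insert None (Some ` set (take n L))"
    "x \<in> insert None (Some ` set (take n L))"
  shows "pref_less (take n L) x y \<longleftrightarrow> pref_less L x y"
proof
  assume "pref_less L x y"
  then obtain i where i: "i < length L" "y = Some (L ! i)"
    "x = None \<or> (\<exists>k<length L. i < k \<and> x = Some (L ! k))"
    by (rule pref_lessE)
  have top: "k < n" if "k < length L" "L ! k \<in> set (take n L)" for k
    using that assms(1) by (auto simp: in_set_conv_nth nth_eq_iff_index_eq)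
  show "pref_less (take n L) x y"
  proof (rule pref_lessI)
    show "i < length (take n L)" using i assms(2) top by auto
    then show "y = Some (take n L ! i)" using i by auto
    show "x = None \<or> (\<exists>k<length (take n L). i < k \<and> x = Some (take n L ! k))"
      using i(3) assms(3) top by fastforce
  qed
qed (rule pref_less_take)

lemma legal_iff_range:
  "legal A I P p \<longleftrightarrow> assignment A I p \<and> (\<forall>a\<in>A. p a \<in> insert None (Some ` set (P a)))"
  by (auto simp: legal_def)

lemma legal_range: "legal A I P p \<Longrightarrow> a \<in> A \<Longrightarrow> p a \<in> insert None (Some ` set (P a))"
  by (simp add: legal_iff_range)

text \<open>Pigeonhole: the agents other than \<open>a\<close> hold at most
  \<open>card A - 1\<close> items, and the top \<open>card A\<close> entries are pairwise
  distinct.\<close>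

lemma ex_free_top_item:
  assumes "finite A" "a \<in> A" "distinct L" "card A \<le> length L"
  obtains b where "b \<in> set (take (card A) L)" "\<And>a'. a' \<in> A - {a} \<Longrightarrow> p a' \<noteq> Some b"
proof -
  define T where "T = set (take (card A) L)"
  \<comment> \<open>\<open>the\<close> maps \<open>None\<close> to an unspecified item. This may add
    a spurious element to \<open>B\<close>, but an image of \<open>A - {a}\<close> still has fewer
    than \<open>card A\<close> elements.\<close>
  define B where "B = (the \<circ> p) ` (A - {a})"
  have "card B \<le> card (A - {a})" unfolding B_def using assms(1) by (intro card_image_le) auto
  also have "\<dots> < card A" using assms(1,2) by (intro psubset_card_mono) auto
  also have "\<dots> = card T" using assms(3,4) by (simp add: T_def distinct_card)
  finally have "\<not> T \<subseteq> B"
    using assms(1) by (metis B_def card_mono finite_Diff finite_imageI not_less)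
  then obtain b where "b \<in> T" "b \<notin> B" by auto
  then show thesis by (intro that[of b]) (force simp: T_def B_def)+
qed

lemma legal_reassign:
  assumes "legal A I P p" "a \<in> A" "b \<in> set (P a)" "set (P a) \<subseteq> I"
    "\<And>a'. a' \<in> A - {a} \<Longrightarrow> p a' \<noteq> Some b"
  shows "legal A I P (p(a := Some b))"
  using assms unfolding legal_def assignment_def by (auto split: if_splits; blast)

lemma not_pareto_optimalI:
  assumes "legal A I P q" "\<And>a. a \<in> A \<Longrightarrow> pref_le (P a) (p a) (q a)" "a \<in> A"
    "pref_less (P a) (p a) (q a)"
  shows "\<not> pareto_optimal A I P p"
  using assms by (auto simp: pareto_optimal_def)

lemma not_pareto_optimal_reassign:
  assumes "legal A I P (p(a := Some b))" "a \<in> A" "pref_less (P a) (p a) (Some b)"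
  shows "\<not> pareto_optimal A I P p"
  using assms by (intro not_pareto_optimalI[of A I P "p(a := Some b)"]) (auto simp: pref_le_def)

text \<open>From full to truncated lists only the legality of \<open>p\<close> is at stake, since a
  truncated improvement is a full one. Conversely, a full improvement \<open>q\<close> is shown to
  stay within the top entries, where both orders agree. Either way, an item outside the top is
  refuted by giving its holder a top item that is free under \<open>p\<close>.\<close>

lemma pareto_optimal_take:
  assumes "finite A" and L: "\<And>a. a \<in> A \<Longrightarrow> distinct (P a)" "\<And>a. a \<in> A \<Longrightarrow> set (P a) \<subseteq> I"
  shows "pareto_optimal A I (\<lambda>a. take (card A) (P a)) p \<longleftrightarrow> pareto_optimal A I P p"
    (is "pareto_optimal A I ?P p \<longleftrightarrow> _")
proof
  have sub: "set (?P a) \<subseteq> set (P a)" for a by (rule set_take_subset)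
  have legal_P: "legal A I P q" if "legal A I ?P q" for q
    using that sub by (fastforce simp: legal_def)
  {
    assume opt: "pareto_optimal A I P p"
    have "p a \<in> insert None (Some ` set (?P a))" if a: "a \<in> A" for a
    proof (rule ccontr)
      assume neg: "\<not> ?thesis"
      with opt a obtain k where k: "k < length (P a)" "p a = Some (P a ! k)"
        using legal_range[of A I P p a] by (auto simp: pareto_optimal_def in_set_conv_nth)
      with neg have "k \<ge> card A" by (force simp: in_set_conv_nth)
      with k have "card A \<le> length (P a)" by simp
      from ex_free_top_item[OF assms(1) a L(1)[OF a] this] obtain b
        where b: "b \<in> set (?P a)" "\<And>a'. a' \<in> A - {a} \<Longrightarrow> p a' \<noteq> Some b" by blast
      from b(1) obtain i where i: "i < card A" "i < length (P a)" "b = P a ! i"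
        by (auto simp: in_set_conv_nth)
      let ?q = "p(a := Some b)"
      have "legal A I P ?q"
        using opt subsetD[OF sub b(1)] L(2)[OF a] b(2)
        by (intro legal_reassign[OF _ a]) (simp_all add: pareto_optimal_def)
      moreover have "pref_less (P a) (p a) (?q a)"
        using i k \<open>k \<ge> card A\<close> by (intro pref_lessI[of i]) auto
      ultimately show False
        using not_pareto_optimal_reassign[of A I P p a b] opt a by simp
    qed
    with opt have "legal A I ?P p" by (simp only: pareto_optimal_def legal_iff_range) simp
    then show "pareto_optimal A I ?P p"
      using opt legal_P pref_less_take[of "card A"] pref_le_take[of "card A"]
      unfolding pareto_optimal_def by meson
  }
  {
    assume opt: "pareto_optimal A I ?P p"
    then have p: "legal A I ?P p" by (simp add: pareto_optimal_def)
    show "pareto_optimal A I P p"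
    proof (rule ccontr)
      assume "\<not> ?thesis"
      with p legal_P obtain q where q: "legal A I P q"
        "\<And>a. a \<in> A \<Longrightarrow> pref_le (P a) (p a) (q a)" "\<exists>a\<in>A. pref_less (P a) (p a) (q a)"
        by (auto simp: pareto_optimal_def)
      have top: "q a \<in> insert None (Some ` set (?P a))" if a: "a \<in> A" for a
      proof (rule ccontr)
        assume neg: "\<not> ?thesis"
        with q a obtain k where k: "k < length (P a)" "q a = Some (P a ! k)"
          using legal_range[of A I P q a] by (auto simp: in_set_conv_nth)
        with neg have "k \<ge> card A" by (force simp: in_set_conv_nth)
        \<comment> \<open>\<open>a\<close> prefers an item outside its top \<open>card A\<close>, so \<open>p\<close> leaves it empty-handed.\<close>
        have "p a = None"
        proof (rule ccontr)
          assume "p a \<noteq> None"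
          then obtain m where m: "m < card A" "m < length (P a)" "p a = Some (P a ! m)"
            using legal_range[OF p a] by (auto simp: in_set_conv_nth)
          show False
            using q(2)[OF a] m k \<open>k \<ge> card A\<close> L(1)[OF a]
            by (auto simp: pref_le_def nth_eq_iff_index_eq elim!: pref_lessE)
        qed
        \<comment> \<open>The empty-handed \<open>a\<close> could take a top item that
          \<open>p\<close> leaves free, a strict gain already visible in the truncated
          lists.\<close>
        have "card A \<le> length (P a)" using k \<open>k \<ge> card A\<close> by simp
        from ex_free_top_item[OF assms(1) a L(1)[OF a] this] obtain b
          where b: "b \<in> set (?P a)" "\<And>a'. a' \<in> A - {a} \<Longrightarrow> p a' \<noteq> Some b" by blast
        let ?q = "p(a := Some b)"
        have "legal A I ?P ?q"
          using b(2) by (intro legal_reassign[OF p a b(1) subset_trans[OF sub L(2)[OF a]]]) simp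
        moreover have "pref_less (?P a) (p a) (?q a)"
          using b(1) \<open>p a = None\<close> by (auto simp: in_set_conv_nth intro: pref_lessI)
        ultimately show False
          using not_pareto_optimal_reassign[of A I ?P p a b] opt a by simp
      qed
      have "pref_less (?P a) (p a) (q a) \<longleftrightarrow> pref_less (P a) (p a) (q a)" if "a \<in> A" for a
        using that top legal_range[OF p] L by (intro pref_less_take_iff) auto
      moreover have "legal A I ?P q"
        using q(1) top by (simp only: legal_iff_range) simp
      ultimately show False
        using not_pareto_optimalI[of A I ?P q p] opt q(2,3) by (auto simp: pref_le_def)
    qed
  }
qed

lemma legal_cong:
  assumes "\<And>a. a \<in> A \<Longrightarrow> P a = P' a" "\<And>a. a \<in> A \<Longrightarrow> p a = p' a"
  shows "legal A I P p \<longleftrightarrow> legal A I P' p'"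
  using assms by (simp add: legal_def assignment_def)

text \<open>Profiles are total functions such as \<open>\<lambda>a. prefs G ! j ! a\<close>, but the
  identities between them are established for agents only.\<close>

lemma pareto_optimal_cong:
  assumes "\<And>a. a \<in> A \<Longrightarrow> P a = P' a" "\<And>a. a \<in> A \<Longrightarrow> p a = p' a"
  shows "pareto_optimal A I P p \<longleftrightarrow> pareto_optimal A I P' p'"
proof -
  have "legal A I P q \<longleftrightarrow> legal A I P' q" for q by (intro legal_cong) (simp_all add: assms)
  moreover have "legal A I P p \<longleftrightarrow> legal A I P' p'" using assms by (rule legal_cong)
  ultimately show ?thesis using assms by (simp add: pareto_optimal_def)
qed

lemma legal_rename:
  assumes "legal A I P p" "inj_on r U" "r ` U \<subseteq> I'" "\<And>a. a \<in> A \<Longrightarrow> set (P a) \<subseteq> U"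
  shows "legal A I' (\<lambda>a. map r (P a)) (\<lambda>a. map_option r (p a))"
proof -
  have item: "\<exists>b\<in>set (P a). p a = Some b \<and> c = r b" if "a \<in> A" "map_option r (p a) = Some c" for a c
    using assms(1) that by (auto simp: legal_def)
  have "c \<in> I'" if "a \<in> A" "map_option r (p a) = Some c" for a c
    using item[OF that] assms(3,4) that(1) by blast
  moreover have "a = a'"
    if a: "a \<in> A" "map_option r (p a) = Some c" and a': "a' \<in> A" "map_option r (p a') = Some c"
    for a a' c
  proof -
    obtain b b' where b: "b \<in> U" "p a = Some b" "c = r b" "b' \<in> U" "p a' = Some b'" "c = r b'"
      using item[OF a] item[OF a'] assms(4) a(1) a'(1) by blast
    then have "b = b'" using assms(2) by (simp add: inj_on_eq_iff)
    then show ?thesis using b a(1) a'(1) assms(1) by (auto simp: legal_def assignment_def)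
  qed
  moreover have "map_option r (p a) = None \<or> (\<exists>c\<in>set (map r (P a)). map_option r (p a) = Some c)"
    if "a \<in> A" for a
    using item[OF that] by (cases "p a") auto
  ultimately show ?thesis unfolding legal_def assignment_def by meson
qed

lemma map_inv_into_rename:
  "inj_on r U \<Longrightarrow> set L \<subseteq> U \<Longrightarrow> map (inv_into U r) (map r L) = L"
  by (simp add: map_idI subset_iff)

text \<open>An improvement for the renamed lists is pulled back along \<open>inv_into U r\<close>.
  One direction suffices, as the converse is this lemma for the inverse renaming. The item sets may
  exceed \<open>U\<close> and its image because no list leaves these.\<close>

lemma pareto_optimal_rename:
  assumes opt: "pareto_optimal A I P p" and r: "inj_on r U" "r ` U \<subseteq> I'" "U \<subseteq> I"
    and P: "\<And>a. a \<in> A \<Longrightarrow> set (P a) \<subseteq> U"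
  shows "pareto_optimal A I' (\<lambda>a. map r (P a)) (\<lambda>a. map_option r (p a))"
    (is "pareto_optimal A I' ?P ?p")
proof -
  have p: "legal A I P p" using opt by (simp add: pareto_optimal_def)
  have less: "pref_less (P a) (p a) (map_option (inv_into U r) y)"
    if a: "a \<in> A" and less_y: "pref_less (?P a) (?p a) y" for a y
  proof -
    from less_y obtain i where "i < length (?P a)" "y = Some (?P a ! i)"
      "?p a = None \<or> (\<exists>k<length (?P a). i < k \<and> ?p a = Some (?P a ! k))"
      by (rule pref_lessE)
    then have i: "i < length (P a)" "y = Some (r (P a ! i))"
      "p a = None \<or> (\<exists>k<length (P a). i < k \<and> ?p a = Some (r (P a ! k)))"
      by auto
    have U: "P a ! k \<in> U" if "k < length (P a)" for k using P[OF a] that by auto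
    \<comment> \<open>Injectivity on \<open>U\<close> turns equality of renamed items into equality
      of items, so the item held keeps its position.\<close>
    have "p a = Some (P a ! k)"
      if "map_option r (p a) = Some (r (P a ! k))" "k < length (P a)" for k
      using that legal_range[OF p a] P[OF a] U r(1) by (auto simp: subset_iff inj_on_eq_iff)
    with i U r(1) show ?thesis by (intro pref_lessI[of i]) auto
  qed
  have "False" if q: "legal A I' ?P q" "\<And>a. a \<in> A \<Longrightarrow> pref_le (?P a) (?p a) (q a)"
    "a \<in> A" "pref_less (?P a) (?p a) (q a)" for q a
  proof -
    let ?q = "\<lambda>a. map_option (inv_into U r) (q a)"
    have "legal A I (\<lambda>a. map (inv_into U r) (?P a)) ?q"
    proof (rule legal_rename[OF q(1)])
      show "inj_on (inv_into U r) (r ` U)" by (rule inj_on_inv_into) simp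
      show "inv_into U r ` r ` U \<subseteq> I" using r by (simp add: image_image)
      show "set (?P a) \<subseteq> r ` U" if "a \<in> A" for a using P[OF that] by auto
    qed
    moreover have "legal A I (\<lambda>a. map (inv_into U r) (?P a)) ?q \<longleftrightarrow> legal A I P ?q"
      using map_inv_into_rename[OF r(1) P] by (intro legal_cong) auto
    moreover have "pref_le (P a) (p a) (?q a)" if "a \<in> A" for a
    proof (cases "?p a = q a")
      case True
      have "map_option (inv_into U r) (?p a) = p a"
        using legal_range[OF p that] P[OF that] r(1) by (auto simp: subset_iff)
      with True have "?q a = p a" by simp
      then show ?thesis by (simp add: pref_le_def)
    next
      case False
      then show ?thesis using less[OF that] q(2)[OF that] by (auto simp: pref_le_def)
    qed
    ultimately show False
      using not_pareto_optimalI[of A I P ?q p a] opt less q(3,4) by auto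
  qed
  then show ?thesis
    using legal_rename[OF p r(1,2) P] by (auto simp: pareto_optimal_def)
qed

section \<open>Polynomially bounded programs\<close>

text \<open>The bound is per variable. An expression mentions a fixed number of variables, so its
  cost is still linear in \<open>M\<close>.\<close>

definition bounded :: "nat \<Rightarrow> state \<Rightarrow> bool" where
  "bounded M s \<longleftrightarrow> (\<forall>x. tree_size (s x) \<le> M)"

text \<open>
  The relation \<open>T M\<close> specifies state transitions of which \<open>M\<close> bounds the data; the running time
  is polynomial in this \<open>M\<close>.
\<close>

definition poly_com :: "com \<Rightarrow> (nat \<Rightarrow> state \<Rightarrow> state \<Rightarrow> bool) \<Rightarrow> bool" where
  "poly_com c T \<longleftrightarrow>
     (\<exists>b :: nat poly. \<forall>M s s'. T M s s' \<longrightarrow> (\<exists>t \<le> poly b M. exec c s t s'))"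

lemma tree_size_pos [simp]: "0 < tree_size t"
  by (cases t) auto

lemma boundedD: "bounded M s \<Longrightarrow> tree_size (s x) \<le> M"
  by (simp add: bounded_def)

lemma bounded_upd: "bounded M s \<Longrightarrow> tree_size v \<le> M \<Longrightarrow> bounded M (s(x := v))"
  by (simp add: bounded_def)

lemma bounded_pos: "bounded M s \<Longrightarrow> 0 < M"
  using tree_size_pos boundedD less_le_trans by blast

lemma bounded_mono: "bounded M s \<Longrightarrow> M \<le> M' \<Longrightarrow> bounded M' s"
  unfolding bounded_def by (meson le_trans)

lemma tree_size_left: "tree_size (left t) \<le> tree_size t"
  by (cases t) auto

lemma tree_size_right: "tree_size (right t) \<le> tree_size t"
  by (cases t) auto

text \<open>\<open>Hd\<close> and \<open>Tl\<close> do not enlarge values, and \<open>Cons\<close>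
  adds two sizes. Fixed contributions, such as a constant or the new root, are absorbed because
  \<open>bounded M s\<close> forces \<open>M\<close> to be positive.\<close>

lemma eval_cost_linear:
  "\<exists>k. \<forall>M s. bounded M s \<longrightarrow> tree_size (eval e s) \<le> k * M \<and> cost e s \<le> k * M"
proof (induction e)
  case (Var x)
  then show ?case by (auto simp: boundedD intro: exI[of _ 1])
next
  case (Const t)
  have "tree_size t \<le> tree_size t * M" if "bounded M s" for M s
    using bounded_pos[OF that] by simp
  then show ?case by (auto intro: exI[of _ "tree_size t"])
next
  case (Cons e f)
  then obtain k l where
    "\<And>M s. bounded M s \<Longrightarrow> tree_size (eval e s) \<le> k * M \<and> cost e s \<le> k * M"
    "\<And>M s. bounded M s \<Longrightarrow> tree_size (eval f s) \<le> l * M \<and> cost f s \<le> l * M" by metis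
  then show ?case
    using bounded_pos by (intro exI[of _ "2 * k + 2 * l + 1"]) (fastforce simp: algebra_simps)
next
  case (Hd e)
  then obtain k where
    "\<And>M s. bounded M s \<Longrightarrow> tree_size (eval e s) \<le> k * M \<and> cost e s \<le> k * M" by metis
  then show ?case
    by (intro exI[of _ "2 * k"])
      (fastforce simp: mult_2 distrib_right intro: add_mono le_trans[OF tree_size_left] trans_le_add1)
next
  case (Tl e)
  then obtain k where
    "\<And>M s. bounded M s \<Longrightarrow> tree_size (eval e s) \<le> k * M \<and> cost e s \<le> k * M" by metis
  then show ?case
    by (intro exI[of _ "2 * k"])
      (fastforce simp: mult_2 distrib_right intro: add_mono le_trans[OF tree_size_right] trans_le_add1)
next
  case (Eq e f)
  then obtain k l where
    "\<And>M s. bounded M s \<Longrightarrow> tree_size (eval e s) \<le> k * M \<and> cost e s \<le> k * M"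
    "\<And>M s. bounded M s \<Longrightarrow> tree_size (eval f s) \<le> l * M \<and> cost f s \<le> l * M" by metis
  then show ?case
    using bounded_pos by (intro exI[of _ "k + l + 3"]) (fastforce simp: algebra_simps)
qed

fun straight :: "com \<Rightarrow> bool" where
  "straight (Seq c d) \<longleftrightarrow> straight c \<and> straight d"
| "straight (If e c d) \<longleftrightarrow> straight c \<and> straight d"
| "straight (While e c) \<longleftrightarrow> False"
| "straight _ \<longleftrightarrow> True"

text \<open>A functional semantics lets the simplifier evaluate loop-free code. Its agreement with
  \<open>exec\<close> is claimed for \<open>straight\<close> commands only.\<close>

fun run :: "com \<Rightarrow> state \<Rightarrow> state" where
  "run (Assign x e) s = s(x := eval e s)"
| "run (Seq c d) s = run d (run c s)"
| "run (If e c d) s = (if eval e s \<noteq> Leaf then run c s else run d s)"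
| "run _ s = s"

text \<open>The bound on the final state is carried along for \<open>Seq\<close>: the second command
  starts from data of size \<open>k * M\<close>, and linear bounds compose.\<close>

lemma exec_straight_linear:
  assumes "straight c"
  shows "\<exists>k. \<forall>M s. bounded M s \<longrightarrow> bounded (k * M) (run c s) \<and> (\<exists>t \<le> k * M. exec c s t (run c s))"
  using assms
proof (induction c)
  case Skip
  have "1 \<le> M" if "bounded M s" for M s using bounded_pos[OF that] by simp
  then show ?case by (auto intro!: exI[of _ 1] exec.Skip)
next
  case (Assign x e)
  obtain k where k: "\<And>M s. bounded M s \<Longrightarrow> tree_size (eval e s) \<le> k * M \<and> cost e s \<le> k * M"
    using eval_cost_linear[of e] by blast
  have "bounded ((k + 1) * M) (s(x := eval e s))" "cost e s \<le> (k + 1) * M" if "bounded M s" for M s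
    using k[OF that] that by (auto intro!: bounded_upd elim: bounded_mono)
  then show ?case unfolding run.simps using exec.Assign by blast
next
  case (Seq c d)
  then obtain k l where
    k: "\<And>M s. bounded M s \<Longrightarrow> bounded (k * M) (run c s) \<and> (\<exists>t \<le> k * M. exec c s t (run c s))" and
    l: "\<And>M s. bounded M s \<Longrightarrow> bounded (l * M) (run d s) \<and> (\<exists>t \<le> l * M. exec d s t (run d s))"
    by (metis straight.simps(1))
  show ?case
  proof (rule exI[of _ "k + l * k"], intro allI impI conjI)
    fix M s assume s: "bounded M s"
    have l': "bounded (l * (k * M)) (run d (run c s))"
      "\<exists>t \<le> l * (k * M). exec d (run c s) t (run d (run c s))"
      using l k[OF s] by blast+
    show "bounded ((k + l * k) * M) (run (Seq c d) s)"
      using l'(1) by (auto elim!: bounded_mono simp: algebra_simps)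
    obtain t u where "t \<le> k * M" "exec c s t (run c s)" "u \<le> l * (k * M)"
      "exec d (run c s) u (run d (run c s))" using l'(2) k[OF s] by blast
    then show "\<exists>t\<le>(k + l * k) * M. exec (Seq c d) s t (run (Seq c d) s)"
      by (intro exI[of _ "t + u"]) (auto intro: exec.Seq simp: algebra_simps)
  qed
next
  case (If e c d)
  then obtain k l where
    k: "\<And>M s. bounded M s \<Longrightarrow> bounded (k * M) (run c s) \<and> (\<exists>t \<le> k * M. exec c s t (run c s))" and
    l: "\<And>M s. bounded M s \<Longrightarrow> bounded (l * M) (run d s) \<and> (\<exists>t \<le> l * M. exec d s t (run d s))"
    by (metis straight.simps(2))
  obtain m where m: "\<And>M s. bounded M s \<Longrightarrow> cost e s \<le> m * M"
    using eval_cost_linear[of e] by blast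
  show ?case
  proof (rule exI[of _ "k + l + m"], intro allI impI conjI)
    fix M s assume s: "bounded M s"
    show "bounded ((k + l + m) * M) (run (If e c d) s)"
      using k[OF s] l[OF s] by (auto elim!: bounded_mono simp: algebra_simps)
    obtain t u where tu: "t \<le> k * M" "exec c s t (run c s)" "u \<le> l * M" "exec d s u (run d s)"
      using k[OF s] l[OF s] by blast
    let ?t = "cost e s + (if eval e s \<noteq> Leaf then t else u)"
    have "exec (If e c d) s ?t (run (If e c d) s)"
      using tu by (auto intro: exec.IfTrue exec.IfFalse)
    moreover have "?t \<le> (k + l + m) * M" using tu m[OF s] by (simp add: add_mult_distrib)
    ultimately show "\<exists>t\<le>(k + l + m) * M. exec (If e c d) s t (run (If e c d) s)" by blast
  qed
qed simp

text \<open>A smaller relation demands less. Each concrete specification below is obtained by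
  checking that it implies the relation produced by the composition rules.\<close>

lemma poly_com_mono: "poly_com c T \<Longrightarrow> (\<And>M s s'. T' M s s' \<Longrightarrow> T M s s') \<Longrightarrow> poly_com c T'"
  unfolding poly_com_def by blast

lemma poly_com_straight:
  assumes "straight c"
  shows "poly_com c (\<lambda>M s s'. bounded M s \<and> s' = run c s)"
proof -
  obtain k where "\<And>M s. bounded M s \<Longrightarrow> \<exists>t \<le> k * M. exec c s t (run c s)"
    using exec_straight_linear[OF assms] by blast
  then show ?thesis unfolding poly_com_def by (intro exI[of _ "[:0, k:]"]) (simp add: mult.commute)
qed

lemma poly_com_Seq:
  assumes "poly_com c T" "poly_com d U"
  shows "poly_com (Seq c d) (\<lambda>M s s''. \<exists>s'. T M s s' \<and> U M s' s'')"
proof -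
  obtain a b :: "nat poly" where a: "\<And>M s s'. T M s s' \<Longrightarrow> \<exists>t \<le> poly a M. exec c s t s'"
    and b: "\<And>M s s'. U M s s' \<Longrightarrow> \<exists>t \<le> poly b M. exec d s t s'"
    using assms unfolding poly_com_def by metis
  have "\<exists>t \<le> poly (a + b) M. exec (Seq c d) s t s''" if "T M s s'" "U M s' s''" for M s s' s''
    using a[OF that(1)] b[OF that(2)] by (auto intro!: add_mono exec.Seq)
  then show ?thesis unfolding poly_com_def by blast
qed

lemma poly_com_If:
  assumes "poly_com c T" "poly_com d U"
  shows "poly_com (If (Var x) c d) (\<lambda>M s s'. bounded M s \<and>
    (if s x \<noteq> Leaf then T M s s' else U M s s'))"
proof -
  obtain a b :: "nat poly" where a: "\<And>M s s'. T M s s' \<Longrightarrow> \<exists>t \<le> poly a M. exec c s t s'"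
    and b: "\<And>M s s'. U M s s' \<Longrightarrow> \<exists>t \<le> poly b M. exec d s t s'"
    using assms unfolding poly_com_def by metis
  have "\<exists>t \<le> poly ([:0, 1:] + a + b) M. exec (If (Var x) c d) s t s'"
    if s: "bounded M s" "if s x \<noteq> Leaf then T M s s' else U M s s'" for M s s'
  proof (cases "s x = Leaf")
    case True
    with s(2) have "U M s s'" by simp
    with b obtain t where "t \<le> poly b M" "exec d s t s'" by blast
    with True boundedD[OF s(1), of x] show ?thesis
      by (intro exI[of _ "cost (Var x) s + t"] conjI exec.IfFalse) auto
  next
    case False
    with s(2) have "T M s s'" by simp
    with a obtain t where "t \<le> poly a M" "exec c s t s'" by blast
    with False boundedD[OF s(1), of x] show ?thesis
      by (intro exI[of _ "cost (Var x) s + t"] conjI exec.IfTrue) auto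
  qed
  then show ?thesis unfolding poly_com_def by blast
qed

text \<open>All intermediate states share the bound \<open>M\<close>, which also limits the number
  of rounds. Hence the cost of a loop is a plain product, with no growth from round to
  round.\<close>

definition loop_rel :: "nat \<Rightarrow> (nat \<Rightarrow> state \<Rightarrow> state \<Rightarrow> bool) \<Rightarrow> nat \<Rightarrow> state \<Rightarrow> state \<Rightarrow> bool" where
  "loop_rel x T M s s' \<longleftrightarrow> (\<exists>n S. s = S 0 \<and> s' = S n \<and> n \<le> M \<and> S n x = Leaf \<and>
     (\<forall>i\<le>n. bounded M (S i)) \<and> (\<forall>i<n. S i x \<noteq> Leaf \<and> T M (S i) (S (Suc i))))"

text \<open>\<open>S xs ys\<close> is the state after the entries \<open>xs\<close>, when the entries \<open>ys\<close> are still to come.\<close>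

lemma loop_rel_listI:
  assumes "s = S [] zs" "s' = S zs []" "length zs \<le> M" "S zs [] x = Leaf"
    and bd: "\<And>xs ys. zs = xs @ ys \<Longrightarrow> bounded M (S xs ys)"
    and step: "\<And>xs y ys. zs = xs @ y # ys \<Longrightarrow> bounded M (S xs (y # ys)) \<Longrightarrow>
      bounded M (S (xs @ [y]) ys) \<Longrightarrow> S xs (y # ys) x \<noteq> Leaf \<and> T M (S xs (y # ys)) (S (xs @ [y]) ys)"
  shows "loop_rel x T M s s'"
proof -
  let ?S = "\<lambda>i. S (take i zs) (drop i zs)"
  have bd': "bounded M (?S i)" for i by (rule bd) simp
  have "?S i x \<noteq> Leaf \<and> T M (?S i) (?S (Suc i))" if "i < length zs" for i
  proof -
    have split: "drop i zs = zs ! i # drop (Suc i) zs" "take (Suc i) zs = take i zs @ [zs ! i]"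
      using that by (simp_all add: Cons_nth_drop_Suc take_Suc_conv_app_nth)
    have "zs = take i zs @ zs ! i # drop (Suc i) zs" using split(1) by (metis append_take_drop_id)
    from step[OF this] show ?thesis using bd'[of i] bd'[of "Suc i"] unfolding split by blast
  qed
  then show ?thesis
    unfolding loop_rel_def using assms(1-4) bd'
    by (intro exI[of _ "length zs"] exI[of _ ?S]) simp
qed

text \<open>At most \<open>M\<close> rounds are run, each with a test of cost at most
  \<open>M\<close> and a body of cost at most \<open>poly b M\<close>; the leading \<open>M\<close>
  pays for the final failing test.\<close>

lemma poly_com_While:
  assumes "poly_com c T"
  shows "poly_com (While (Var x) c) (loop_rel x T)"
proof -
  obtain b :: "nat poly" where b: "\<And>M s s'. T M s s' \<Longrightarrow> \<exists>t \<le> poly b M. exec c s t s'"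
    using assms unfolding poly_com_def by metis
  have "\<exists>t \<le> poly ([:0, 1:] + [:0, 1:] * ([:0, 1:] + b)) M. exec (While (Var x) c) s t s'"
    if loop: "loop_rel x T M s s'" for M s s'
  proof -
    obtain n S where S: "s = S 0" "s' = S n" "n \<le> M" "S n x = Leaf" "\<And>i. i \<le> n \<Longrightarrow> bounded M (S i)"
      "\<And>i. i < n \<Longrightarrow> S i x \<noteq> Leaf" "\<And>i. i < n \<Longrightarrow> T M (S i) (S (Suc i))"
      using loop unfolding loop_rel_def by metis
    have cost: "cost (Var x) (S i) \<le> M" if "i \<le> n" for i
      using boundedD[OF S(5)[OF that]] by simp
    \<comment> \<open>Induction on the number \<open>k\<close> of rounds still to run, because
      \<open>exec.WhileTrue\<close> recurses on the rest of the loop.\<close>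
    have "\<exists>t \<le> M + k * (M + poly b M). exec (While (Var x) c) (S (n - k)) t (S n)" if "k \<le> n" for k
      using that
    proof (induction k)
      case 0
      have "exec (While (Var x) c) (S n) (cost (Var x) (S n)) (S n)"
        using S(4) by (intro exec.WhileFalse) simp
      then show ?case using cost[of n] by fastforce
    next
      case (Suc k)
      then have k: "n - Suc k < n" "Suc (n - Suc k) = n - k" by auto
      obtain t where t: "t \<le> M + k * (M + poly b M)" "exec (While (Var x) c) (S (n - k)) t (S n)"
        using Suc by fastforce
      obtain u where u: "u \<le> poly b M" "exec c (S (n - Suc k)) u (S (n - k))"
        using b[OF S(7)[OF k(1)]] unfolding k(2) by blast
      have "exec (While (Var x) c) (S (n - Suc k)) (cost (Var x) (S (n - Suc k)) + u + t) (S n)"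
        using t(2) u(2) S(6)[OF k(1)] by (intro exec.WhileTrue) simp_all
      moreover have "cost (Var x) (S (n - Suc k)) + u + t \<le> M + Suc k * (M + poly b M)"
        using t(1) u(1) cost[of "n - Suc k"] by simp
      ultimately show ?case by blast
    qed
    from this[of n] obtain t where "t \<le> M + n * (M + poly b M)" "exec (While (Var x) c) s t s'"
      unfolding S(1,2) by auto
    moreover have "n * (M + poly b M) \<le> M * (M + poly b M)" using S(3) by (rule mult_le_mono1)
    moreover have "poly ([:0, 1:] + [:0, 1:] * ([:0, 1:] + b)) M = M + M * (M + poly b M)" by simp
    ultimately show ?thesis by (metis add_le_cancel_left le_trans)
  qed
  then show ?thesis unfolding poly_com_def by blast
qed

text \<open>The body of a nested loop: \<open>c\<close> loads the current element, the inner program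
  satisfies \<open>T\<close>, and \<open>d\<close> stores the result and clears scratch
  variables.\<close>

definition sandwich_rel ::
  "com \<Rightarrow> (nat \<Rightarrow> state \<Rightarrow> state \<Rightarrow> bool) \<Rightarrow> com \<Rightarrow> nat \<Rightarrow> state \<Rightarrow> state \<Rightarrow> bool" where
  "sandwich_rel c T d M s s' \<longleftrightarrow>
     bounded M s \<and> (\<exists>s''. T M (run c s) s'' \<and> bounded M s'' \<and> s' = run d s'')"

lemma sandwich_relI:
  "bounded M s \<Longrightarrow> s1 = run c s \<Longrightarrow> T M s1 s2 \<Longrightarrow> bounded M s2 \<Longrightarrow> s' = run d s2 \<Longrightarrow>
    sandwich_rel c T d M s s'"
  unfolding sandwich_rel_def by blast

lemma poly_com_sandwich:
  assumes "straight c" "straight d" "poly_com e T"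
  shows "poly_com (Seq c (Seq e d)) (sandwich_rel c T d)"
  by (rule poly_com_mono[OF poly_com_Seq[OF poly_com_straight[OF assms(1)]
      poly_com_Seq[OF assms(3) poly_com_straight[OF assms(2)]]]])
    (auto simp: sandwich_rel_def)

section \<open>The kernelization program\<close>

text \<open>
  Two passes, truncation and renaming, each reverse all lists at every nesting level, so that
  together they restore the order. Variables 3, 4 and 5 hold the remaining layers, the remaining
  lists of the current layer and the remaining entries of the current list; the truncated
  counterparts are built in 7, 8 and 9. The second pass uses the two groups in exchanged roles.
  Variable 1 holds the number of agents, 10 all truncated entries in reverse, 11 their
  number, and 6 and 12 are scratch.
\<close>

abbreviation enc_nats :: "nat list \<Rightarrow> tree" where
  "enc_nats \<equiv> enc_list enc_nat"

abbreviation enc_layer :: "nat list list \<Rightarrow> tree" where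
  "enc_layer \<equiv> enc_list enc_nats"

abbreviation enc_prefs :: "nat list list list \<Rightarrow> tree" where
  "enc_prefs \<equiv> enc_list enc_layer"

text \<open>The size of an encoded list without its final \<open>Leaf\<close>. Unlike
  \<open>tree_size\<close>, it is additive under append and invariant under reversal, which suits
  passes that reverse their lists.\<close>

definition weight :: "('a \<Rightarrow> tree) \<Rightarrow> 'a list \<Rightarrow> nat" where
  "weight f xs = (\<Sum>x\<leftarrow>xs. Suc (tree_size (f x)))"

lemma weight_simps [simp]:
  "weight f [] = 0"
  "weight f (x # xs) = Suc (tree_size (f x)) + weight f xs"
  "weight f (xs @ ys) = weight f xs + weight f ys"
  by (simp_all add: weight_def)

lemma weight_rev [simp]: "weight f (rev xs) = weight f xs"
  by (induction xs) simp_all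

lemma tree_size_enc_list [simp]: "tree_size (enc_list f xs) = Suc (weight f xs)"
  by (induction xs) simp_all

lemma weight_take: "weight f (take n xs) \<le> weight f xs"
  by (metis append_take_drop_id le_add1 weight_simps(3))

text \<open>Every cell has its own node and at least one node of content. So a size bound limits the
  rounds of a loop, and a unary counter is no larger than the list that it counts.\<close>

lemma weight_ge_length: "2 * length xs \<le> weight f xs"
proof (induction xs)
  case (Cons x xs)
  then show ?case using tree_size_pos[of "f x"] by (simp del: tree_size_pos)
qed simp

lemma enc_nat_simps [simp]:
  "enc_nat 0 = Leaf"
  "enc_nat (Suc k) = Node Leaf (enc_nat k)"
  by (simp_all add: enc_nat_def)

lemma enc_nat_eq_Leaf_iff [simp]: "enc_nat k = Leaf \<longleftrightarrow> k = 0"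
  by (cases k) simp_all

lemma tree_size_enc_nat [simp]: "tree_size (enc_nat k) = Suc (2 * k)"
  by (induction k) simp_all

lemma right_enc_nat [simp]: "right (enc_nat k) = enc_nat (k - 1)"
  by (cases k) simp_all

lemma enc_nat_eq_iff [simp]: "enc_nat j = enc_nat k \<longleftrightarrow> j = k"
  using inj_enc_nat by (simp add: inj_eq)

section \<open>The truncation pass\<close>

definition trunc_step :: com where
  "trunc_step = Seq
     (If (Var 6)
       (Seq (Assign 9 (Cons (Hd (Var 5)) (Var 9)))
       (Seq (Assign 10 (Cons (Hd (Var 5)) (Var 10)))
       (Seq (Assign 11 (Cons (Const Leaf) (Var 11)))
         (Assign 6 (Tl (Var 6))))))
       Skip)
     (Assign 5 (Tl (Var 5)))"

definition trunc_list :: com where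
  "trunc_list = While (Var 5) trunc_step"

text \<open>\<open>bounded M s'\<close> is part of the premise: unread input only shrinks and output
  only grows, so bounds at both ends cover all states in between. The other passes over lists follow
  the same pattern.\<close>

definition trunc_list_rel :: "nat \<Rightarrow> state \<Rightarrow> state \<Rightarrow> bool" where
  "trunc_list_rel M s s' \<longleftrightarrow> (\<exists>L n F.
     s 5 = enc_nats L \<and> s 6 = enc_nat n \<and> s 9 = Leaf \<and> s 10 = enc_nats F \<and>
     s 11 = enc_nat (length F) \<and> bounded M s \<and> bounded M s' \<and>
     s' = s(5 := Leaf, 6 := enc_nat (n - length L), 9 := enc_nats (rev (take n L)),
       10 := enc_nats (rev (take n L) @ F), 11 := enc_nat (length (rev (take n L) @ F))))"

lemma poly_com_trunc_list: "poly_com trunc_list trunc_list_rel"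
  unfolding trunc_list_def
proof (rule poly_com_mono[OF poly_com_While[OF poly_com_straight]])
  show "straight trunc_step" by (simp add: trunc_step_def)
  fix M s s'
  assume "trunc_list_rel M s s'"
  then obtain L n F where s: "s 5 = enc_nats L" "s 6 = enc_nat n" "s 9 = Leaf"
      "s 10 = enc_nats F" "s 11 = enc_nat (length F)" "bounded M s" "bounded M s'" and
    s': "s' = s(5 := Leaf, 6 := enc_nat (n - length L), 9 := enc_nats (rev (take n L)),
       10 := enc_nats (rev (take n L) @ F), 11 := enc_nat (length (rev (take n L) @ F)))"
    unfolding trunc_list_rel_def by blast
  \<comment> \<open>Variable 6 is the remaining quota. Subtraction on \<open>nat\<close> keeps it at
    0 once \<open>n\<close> entries are kept; later entries are consumed and dropped.\<close>
  let ?S = "\<lambda>xs ys. s(5 := enc_nats ys, 6 := enc_nat (n - length xs),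
       9 := enc_nats (rev (take n xs)), 10 := enc_nats (rev (take n xs) @ F),
       11 := enc_nat (length (rev (take n xs) @ F)))"
  have b: "weight enc_nat L < M" "2 * n < M" "weight enc_nat (take n L) + weight enc_nat F < M"
    "2 * length (take n L) + 2 * length F < M"
    using boundedD[OF s(6), of 5] boundedD[OF s(6), of 6] boundedD[OF s(7), of 10]
      boundedD[OF s(7), of 11] s(1-5) s' by simp_all
  show "loop_rel 5 (\<lambda>M s s'. bounded M s \<and> s' = run trunc_step s) M s s'"
  proof (rule loop_rel_listI[where S = ?S and zs = L])
    show "bounded M (?S xs ys)" if "L = xs @ ys" for xs ys
      using b unfolding that by (intro bounded_upd s(6)) auto
    show "length L \<le> M" using b(1) weight_ge_length[of L enc_nat] by simp
    show "?S xs (y # ys) 5 \<noteq> Leaf \<and> bounded M (?S xs (y # ys)) \<and>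
      ?S (xs @ [y]) ys = run trunc_step (?S xs (y # ys))"
      if "L = xs @ y # ys" "bounded M (?S xs (y # ys))" for xs y ys
    proof (cases "length xs < n")
      case True
      then obtain k where "n - length xs = Suc k" by (metis Suc_diff_Suc)
      then show ?thesis using that(2) by (auto simp: fun_eq_iff trunc_step_def)
    next
      case False
      then show ?thesis using that(2) by (auto simp: fun_eq_iff trunc_step_def)
    qed
  qed (use s s' in \<open>auto simp: fun_eq_iff\<close>)
qed

definition trunc_layer :: com where
  "trunc_layer = While (Var 4)
     (Seq (Seq (Assign 5 (Hd (Var 4))) (Seq (Assign 4 (Tl (Var 4))) (Assign 6 (Var 1))))
     (Seq trunc_list
       (Seq (Assign 8 (Cons (Var 9) (Var 8)))
       (Seq (Assign 9 (Const Leaf))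
         (Assign 6 (Const Leaf))))))"

definition trunc_layer_rel :: "nat \<Rightarrow> state \<Rightarrow> state \<Rightarrow> bool" where
  "trunc_layer_rel M s s' \<longleftrightarrow> (\<exists>P n F.
     s 1 = enc_nat n \<and> s 4 = enc_layer P \<and> s 5 = Leaf \<and> s 6 = Leaf \<and> s 8 = Leaf \<and> s 9 = Leaf \<and>
     s 10 = enc_nats F \<and> s 11 = enc_nat (length F) \<and> bounded M s \<and> bounded M s' \<and>
     s' = s(4 := Leaf, 8 := enc_layer (rev (map (rev \<circ> take n) P)),
       10 := enc_nats (rev (concat (map (take n) P)) @ F),
       11 := enc_nat (length (rev (concat (map (take n) P)) @ F))))"

lemma poly_com_trunc_layer: "poly_com trunc_layer trunc_layer_rel"
  unfolding trunc_layer_def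
proof (rule poly_com_mono[OF poly_com_While[OF poly_com_sandwich[OF _ _ poly_com_trunc_list]]])
  let ?pre = "Seq (Assign 5 (Hd (Var 4))) (Seq (Assign 4 (Tl (Var 4))) (Assign 6 (Var 1)))"
  \<comment> \<open>The next call of \<open>trunc_list\<close> expects variable 9 to be empty, and
    the loop state \<open>?S\<close> changes neither 9 nor 6, so both are cleared.\<close>
  let ?post = "Seq (Assign 8 (Cons (Var 9) (Var 8))) (Seq (Assign 9 (Const Leaf)) (Assign 6 (Const Leaf)))"
  fix M s s'
  assume "trunc_layer_rel M s s'"
  then obtain P n F where s: "s 1 = enc_nat n" "s 4 = enc_layer P" "s 5 = Leaf" "s 6 = Leaf"
      "s 8 = Leaf" "s 9 = Leaf" "s 10 = enc_nats F" "s 11 = enc_nat (length F)"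
      "bounded M s" "bounded M s'" and
    s': "s' = s(4 := Leaf, 8 := enc_layer (rev (map (rev \<circ> take n) P)),
       10 := enc_nats (rev (concat (map (take n) P)) @ F),
       11 := enc_nat (length (rev (concat (map (take n) P)) @ F)))"
    unfolding trunc_layer_rel_def by blast
  let ?S = "\<lambda>xs ys. s(4 := enc_layer ys, 8 := enc_layer (rev (map (rev \<circ> take n) xs)),
       10 := enc_nats (rev (concat (map (take n) xs)) @ F),
       11 := enc_nat (length (rev (concat (map (take n) xs)) @ F)))"
  have b: "2 * n < M" "weight enc_nats P < M" "weight enc_nats (map (rev \<circ> take n) P) < M"
    "weight enc_nat (concat (map (take n) P)) + weight enc_nat F < M"
    "2 * length (concat (map (take n) P)) + 2 * length F < M"
    using boundedD[OF s(9), of 1] boundedD[OF s(9), of 4] boundedD[OF s(10), of 8]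
      boundedD[OF s(10), of 10] boundedD[OF s(10), of 11] s(1-8) s' by simp_all
  show "loop_rel 4 (sandwich_rel ?pre trunc_list_rel ?post) M s s'"
  proof (rule loop_rel_listI[where S = ?S and zs = P])
    show "bounded M (?S xs ys)" if "P = xs @ ys" for xs ys
      using b unfolding that by (intro bounded_upd s(9)) auto
    show "length P \<le> M" using b(2) weight_ge_length[of P enc_nats] by simp
    fix xs y ys
    assume P: "P = xs @ y # ys" and S: "bounded M (?S xs (y # ys))"
    let ?s1 = "(?S xs ys)(5 := enc_nats y, 6 := enc_nat n)"
    let ?s2 = "?s1(5 := Leaf, 6 := enc_nat (n - length y), 9 := enc_nats (rev (take n y)),
       10 := enc_nats (rev (take n y) @ rev (concat (map (take n) xs)) @ F),
       11 := enc_nat (length (rev (take n y) @ rev (concat (map (take n) xs)) @ F)))"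
    have s1: "bounded M ?s1" and s2: "bounded M ?s2"
      using b weight_take[of enc_nat n y] unfolding P by (intro bounded_upd s(9); simp)+
    have rel: "trunc_list_rel M ?s1 ?s2"
      unfolding trunc_list_rel_def using s s1 s2
      by (intro exI[of _ y] exI[of _ n] exI[of _ "rev (concat (map (take n) xs)) @ F"]) simp
    have pre: "?s1 = run ?pre (?S xs (y # ys))"
      using s by (auto simp: fun_eq_iff)
    have post: "?S (xs @ [y]) ys = run ?post ?s2"
      using s by (auto simp: fun_eq_iff)
    show "?S xs (y # ys) 4 \<noteq> Leaf \<and>
        sandwich_rel ?pre trunc_list_rel ?post M (?S xs (y # ys)) (?S (xs @ [y]) ys)"
      by (intro conjI sandwich_relI[where T = trunc_list_rel, OF S pre rel s2 post]) simp
  qed (use s s' in \<open>auto simp: fun_eq_iff\<close>)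
qed simp_all

definition trunc_prefs :: com where
  "trunc_prefs = While (Var 3)
     (Seq (Seq (Assign 4 (Hd (Var 3))) (Assign 3 (Tl (Var 3))))
     (Seq trunc_layer
       (Seq (Assign 7 (Cons (Var 8) (Var 7))) (Assign 8 (Const Leaf)))))"

definition trunc_prefs_rel :: "nat \<Rightarrow> state \<Rightarrow> state \<Rightarrow> bool" where
  "trunc_prefs_rel M s s' \<longleftrightarrow> (\<exists>R n F.
     s 1 = enc_nat n \<and> s 3 = enc_prefs R \<and> s 4 = Leaf \<and> s 5 = Leaf \<and> s 6 = Leaf \<and> s 7 = Leaf \<and>
     s 8 = Leaf \<and> s 9 = Leaf \<and> s 10 = enc_nats F \<and> s 11 = enc_nat (length F) \<and>
     bounded M s \<and> bounded M s' \<and>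
     s' = s(3 := Leaf, 7 := enc_prefs (rev (map (\<lambda>P. rev (map (rev \<circ> take n) P)) R)),
       10 := enc_nats (rev (concat (map (concat \<circ> map (take n)) R)) @ F),
       11 := enc_nat (length (rev (concat (map (concat \<circ> map (take n)) R)) @ F))))"

lemma poly_com_trunc_prefs: "poly_com trunc_prefs trunc_prefs_rel"
  unfolding trunc_prefs_def
proof (rule poly_com_mono[OF poly_com_While[OF poly_com_sandwich[OF _ _ poly_com_trunc_layer]]])
  let ?pre = "Seq (Assign 4 (Hd (Var 3))) (Assign 3 (Tl (Var 3)))"
  let ?post = "Seq (Assign 7 (Cons (Var 8) (Var 7))) (Assign 8 (Const Leaf))"
  fix M s s'
  assume "trunc_prefs_rel M s s'"
  then obtain R n F where s: "s 1 = enc_nat n" "s 3 = enc_prefs R" "s 4 = Leaf" "s 5 = Leaf"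
      "s 6 = Leaf" "s 7 = Leaf" "s 8 = Leaf" "s 9 = Leaf" "s 10 = enc_nats F"
      "s 11 = enc_nat (length F)" "bounded M s" "bounded M s'" and
    s': "s' = s(3 := Leaf, 7 := enc_prefs (rev (map (\<lambda>P. rev (map (rev \<circ> take n) P)) R)),
       10 := enc_nats (rev (concat (map (concat \<circ> map (take n)) R)) @ F),
       11 := enc_nat (length (rev (concat (map (concat \<circ> map (take n)) R)) @ F)))"
    unfolding trunc_prefs_rel_def by blast
  let ?S = "\<lambda>xs ys. s(3 := enc_prefs ys,
       7 := enc_prefs (rev (map (\<lambda>P. rev (map (rev \<circ> take n) P)) xs)),
       10 := enc_nats (rev (concat (map (concat \<circ> map (take n)) xs)) @ F),
       11 := enc_nat (length (rev (concat (map (concat \<circ> map (take n)) xs)) @ F)))"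
  have b: "weight enc_layer R < M"
    "weight enc_layer (map (\<lambda>P. rev (map (rev \<circ> take n) P)) R) < M"
    "weight enc_nat (concat (map (concat \<circ> map (take n)) R)) + weight enc_nat F < M"
    "2 * length (concat (map (concat \<circ> map (take n)) R)) + 2 * length F < M"
    using boundedD[OF s(11), of 3] boundedD[OF s(12), of 7]
      boundedD[OF s(12), of 10] boundedD[OF s(12), of 11] s(1-10) s' by simp_all
  show "loop_rel 3 (sandwich_rel ?pre trunc_layer_rel ?post) M s s'"
  proof (rule loop_rel_listI[where S = ?S and zs = R])
    show "bounded M (?S xs ys)" if "R = xs @ ys" for xs ys
      using b unfolding that by (intro bounded_upd s(11)) auto
    show "length R \<le> M" using b(1) weight_ge_length[of R enc_layer] by simp
    fix xs y ys
    assume R: "R = xs @ y # ys" and S: "bounded M (?S xs (y # ys))"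
    let ?F = "rev (concat (map (concat \<circ> map (take n)) xs)) @ F"
    let ?s1 = "(?S xs ys)(4 := enc_layer y)"
    let ?s2 = "?s1(4 := Leaf, 8 := enc_layer (rev (map (rev \<circ> take n) y)),
       10 := enc_nats (rev (concat (map (take n) y)) @ ?F),
       11 := enc_nat (length (rev (concat (map (take n) y)) @ ?F)))"
    have s1: "bounded M ?s1" and s2: "bounded M ?s2"
      using b unfolding R by (intro bounded_upd s(11); simp)+
    have rel: "trunc_layer_rel M ?s1 ?s2"
      unfolding trunc_layer_rel_def using s s1 s2
      by (intro exI[of _ y] exI[of _ n] exI[of _ ?F]) simp
    have pre: "?s1 = run ?pre (?S xs (y # ys))"
      using s by (auto simp: fun_eq_iff)
    have post: "?S (xs @ [y]) ys = run ?post ?s2"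
      using s by (auto simp: fun_eq_iff)
    show "?S xs (y # ys) 3 \<noteq> Leaf \<and>
        sandwich_rel ?pre trunc_layer_rel ?post M (?S xs (y # ys)) (?S (xs @ [y]) ys)"
      by (intro conjI sandwich_relI[where T = trunc_layer_rel, OF S pre rel s2 post]) simp
  qed (use s s' in \<open>auto simp: fun_eq_iff\<close>)
qed simp_all

text \<open>
  The number of entries after the last occurrence of \<open>x\<close>. On the reversed list of entries kept in
  variable 10, this is the index of the first occurrence of \<open>x\<close>, found without an early exit.
\<close>

definition entries_after :: "nat list \<Rightarrow> nat \<Rightarrow> nat" where
  "entries_after F x = fold (\<lambda>y k. if y = x then 0 else Suc k) F 0"

lemma entries_after_snoc: "entries_after (F @ [y]) x = (if y = x then 0 else Suc (entries_after F x))"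
  by (simp add: entries_after_def)

lemma entries_after_le: "entries_after F x \<le> length F"
  by (induction F rule: rev_induct) (auto simp: entries_after_snoc, simp add: entries_after_def)

section \<open>The renaming pass\<close>

definition lookup_step :: com where
  "lookup_step = Seq
     (If (Eq (Hd (Var 12)) (Hd (Var 9))) (Assign 6 (Const Leaf)) (Assign 6 (Cons (Const Leaf) (Var 6))))
     (Assign 12 (Tl (Var 12)))"

definition lookup :: com where
  "lookup = While (Var 12) lookup_step"

text \<open>The sought entry is read in place, as the head of the list in variable 9. The bound for
  \<open>F\<close> also covers the result, a unary count of entries of \<open>F\<close>.\<close>

definition lookup_rel :: "nat \<Rightarrow> state \<Rightarrow> state \<Rightarrow> bool" where
  "lookup_rel M s s' \<longleftrightarrow> (\<exists>F x.
     left (s 9) = enc_nat x \<and> s 12 = enc_nats F \<and> s 6 = Leaf \<and> bounded M s \<and>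
     s' = s(6 := enc_nat (entries_after F x), 12 := Leaf))"

lemma poly_com_lookup: "poly_com lookup lookup_rel"
  unfolding lookup_def
proof (rule poly_com_mono[OF poly_com_While[OF poly_com_straight]])
  show "straight lookup_step" by (simp add: lookup_step_def)
  fix M s s'
  assume "lookup_rel M s s'"
  then obtain F x where s: "left (s 9) = enc_nat x" "s 12 = enc_nats F" "s 6 = Leaf" "bounded M s" and
    s': "s' = s(6 := enc_nat (entries_after F x), 12 := Leaf)"
    unfolding lookup_rel_def by blast
  let ?S = "\<lambda>xs ys. s(6 := enc_nat (entries_after xs x), 12 := enc_nats ys)"
  have b: "weight enc_nat F < M"
    using boundedD[OF s(4), of 12] s(2) by simp
  show "loop_rel 12 (\<lambda>M s s'. bounded M s \<and> s' = run lookup_step s) M s s'"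
  proof (rule loop_rel_listI[where S = ?S and zs = F])
    show "bounded M (?S xs ys)" if "F = xs @ ys" for xs ys
      using b entries_after_le[of xs x] weight_ge_length[of xs enc_nat] unfolding that
      by (intro bounded_upd s(4)) auto
    show "length F \<le> M" using b weight_ge_length[of F enc_nat] by simp
    show "?S xs (y # ys) 12 \<noteq> Leaf \<and> bounded M (?S xs (y # ys)) \<and>
      ?S (xs @ [y]) ys = run lookup_step (?S xs (y # ys))"
      if "bounded M (?S xs (y # ys))" for xs y ys
      using that s by (auto simp: fun_eq_iff lookup_step_def entries_after_snoc)
  qed (use s s' in \<open>auto simp: fun_eq_iff entries_after_def\<close>)
qed

definition rename_list :: com where
  "rename_list = While (Var 9)
     (Seq (Assign 12 (Var 10))
     (Seq lookup
       (Seq (Assign 5 (Cons (Var 6) (Var 5)))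
       (Seq (Assign 6 (Const Leaf))
         (Assign 9 (Tl (Var 9)))))))"

definition rename_list_rel :: "nat \<Rightarrow> state \<Rightarrow> state \<Rightarrow> bool" where
  "rename_list_rel M s s' \<longleftrightarrow> (\<exists>L F.
     s 5 = Leaf \<and> s 6 = Leaf \<and> s 9 = enc_nats L \<and> s 10 = enc_nats F \<and> s 12 = Leaf \<and>
     bounded M s \<and> bounded M s' \<and>
     s' = s(5 := enc_nats (rev (map (entries_after F) L)), 9 := Leaf))"

lemma poly_com_rename_list: "poly_com rename_list rename_list_rel"
  unfolding rename_list_def
proof (rule poly_com_mono[OF poly_com_While[OF poly_com_sandwich[OF _ _ poly_com_lookup]]])
  let ?pre = "Assign 12 (Var 10)"
  let ?post = "Seq (Assign 5 (Cons (Var 6) (Var 5))) (Seq (Assign 6 (Const Leaf)) (Assign 9 (Tl (Var 9))))"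
  fix M s s'
  assume "rename_list_rel M s s'"
  then obtain L F where s: "s 5 = Leaf" "s 6 = Leaf" "s 9 = enc_nats L" "s 10 = enc_nats F"
      "s 12 = Leaf" "bounded M s" "bounded M s'" and
    s': "s' = s(5 := enc_nats (rev (map (entries_after F) L)), 9 := Leaf)"
    unfolding rename_list_rel_def by blast
  let ?S = "\<lambda>xs ys. s(5 := enc_nats (rev (map (entries_after F) xs)), 9 := enc_nats ys)"
  have b: "weight enc_nat L < M" "weight enc_nat F < M" "weight enc_nat (map (entries_after F) L) < M"
    using boundedD[OF s(6), of 9] boundedD[OF s(6), of 10] boundedD[OF s(7), of 5] s(1-5) s'
    by simp_all
  show "loop_rel 9 (sandwich_rel ?pre lookup_rel ?post) M s s'"
  proof (rule loop_rel_listI[where S = ?S and zs = L])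
    show "bounded M (?S xs ys)" if "L = xs @ ys" for xs ys
      using b unfolding that by (intro bounded_upd s(6)) auto
    show "length L \<le> M" using b(1) weight_ge_length[of L enc_nat] by simp
    fix xs y ys
    assume L: "L = xs @ y # ys" and S: "bounded M (?S xs (y # ys))"
    let ?s1 = "(?S xs (y # ys))(12 := enc_nats F)"
    let ?s2 = "?s1(6 := enc_nat (entries_after F y), 12 := Leaf)"
    have s1: "bounded M ?s1" and s2: "bounded M ?s2"
      using b unfolding L by (intro bounded_upd s(6); simp)+
    have rel: "lookup_rel M ?s1 ?s2"
      unfolding lookup_rel_def using s s1
      by (intro exI[of _ F] exI[of _ y]) simp
    have pre: "?s1 = run ?pre (?S xs (y # ys))"
      using s by (auto simp: fun_eq_iff)
    have post: "?S (xs @ [y]) ys = run ?post ?s2"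
      using s by (auto simp: fun_eq_iff)
    show "?S xs (y # ys) 9 \<noteq> Leaf \<and>
        sandwich_rel ?pre lookup_rel ?post M (?S xs (y # ys)) (?S (xs @ [y]) ys)"
      by (intro conjI sandwich_relI[where T = lookup_rel, OF S pre rel s2 post]) simp
  qed (use s s' in \<open>auto simp: fun_eq_iff\<close>)
qed simp_all

definition rename_layer :: com where
  "rename_layer = While (Var 8)
     (Seq (Seq (Assign 9 (Hd (Var 8))) (Assign 8 (Tl (Var 8))))
     (Seq rename_list
       (Seq (Assign 4 (Cons (Var 5) (Var 4))) (Assign 5 (Const Leaf)))))"

definition rename_layer_rel :: "nat \<Rightarrow> state \<Rightarrow> state \<Rightarrow> bool" where
  "rename_layer_rel M s s' \<longleftrightarrow> (\<exists>P F.
     s 4 = Leaf \<and> s 5 = Leaf \<and> s 6 = Leaf \<and> s 8 = enc_layer P \<and> s 9 = Leaf \<and> s 10 = enc_nats F \<and>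
     s 12 = Leaf \<and> bounded M s \<and> bounded M s' \<and>
     s' = s(4 := enc_layer (rev (map (rev \<circ> map (entries_after F)) P)), 8 := Leaf))"

lemma poly_com_rename_layer: "poly_com rename_layer rename_layer_rel"
  unfolding rename_layer_def
proof (rule poly_com_mono[OF poly_com_While[OF poly_com_sandwich[OF _ _ poly_com_rename_list]]])
  let ?pre = "Seq (Assign 9 (Hd (Var 8))) (Assign 8 (Tl (Var 8)))"
  let ?post = "Seq (Assign 4 (Cons (Var 5) (Var 4))) (Assign 5 (Const Leaf))"
  fix M s s'
  assume "rename_layer_rel M s s'"
  then obtain P F where s: "s 4 = Leaf" "s 5 = Leaf" "s 6 = Leaf" "s 8 = enc_layer P" "s 9 = Leaf"
      "s 10 = enc_nats F" "s 12 = Leaf" "bounded M s" "bounded M s'" and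
    s': "s' = s(4 := enc_layer (rev (map (rev \<circ> map (entries_after F)) P)), 8 := Leaf)"
    unfolding rename_layer_rel_def by blast
  let ?S = "\<lambda>xs ys. s(4 := enc_layer (rev (map (rev \<circ> map (entries_after F)) xs)), 8 := enc_layer ys)"
  have b: "weight enc_nats P < M" "weight enc_nats (map (rev \<circ> map (entries_after F)) P) < M"
    using boundedD[OF s(8), of 8] boundedD[OF s(9), of 4] s(1-7) s' by simp_all
  show "loop_rel 8 (sandwich_rel ?pre rename_list_rel ?post) M s s'"
  proof (rule loop_rel_listI[where S = ?S and zs = P])
    show "bounded M (?S xs ys)" if "P = xs @ ys" for xs ys
      using b unfolding that by (intro bounded_upd s(8)) auto
    show "length P \<le> M" using b(1) weight_ge_length[of P enc_nats] by simp
    fix xs y ys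
    assume P: "P = xs @ y # ys" and S: "bounded M (?S xs (y # ys))"
    let ?s1 = "(?S xs ys)(9 := enc_nats y)"
    let ?s2 = "?s1(5 := enc_nats (rev (map (entries_after F) y)), 9 := Leaf)"
    have s1: "bounded M ?s1" and s2: "bounded M ?s2"
      using b unfolding P by (intro bounded_upd s(8); simp)+
    have rel: "rename_list_rel M ?s1 ?s2"
      unfolding rename_list_rel_def using s s1 s2
      by (intro exI[of _ y] exI[of _ F]) simp
    have pre: "?s1 = run ?pre (?S xs (y # ys))"
      using s by (auto simp: fun_eq_iff)
    have post: "?S (xs @ [y]) ys = run ?post ?s2"
      using s by (auto simp: fun_eq_iff)
    show "?S xs (y # ys) 8 \<noteq> Leaf \<and>
        sandwich_rel ?pre rename_list_rel ?post M (?S xs (y # ys)) (?S (xs @ [y]) ys)"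
      by (intro conjI sandwich_relI[where T = rename_list_rel, OF S pre rel s2 post]) simp
  qed (use s s' in \<open>auto simp: fun_eq_iff\<close>)
qed simp_all

definition rename_prefs :: com where
  "rename_prefs = While (Var 7)
     (Seq (Seq (Assign 8 (Hd (Var 7))) (Assign 7 (Tl (Var 7))))
     (Seq rename_layer
       (Seq (Assign 3 (Cons (Var 4) (Var 3))) (Assign 4 (Const Leaf)))))"

definition rename_prefs_rel :: "nat \<Rightarrow> state \<Rightarrow> state \<Rightarrow> bool" where
  "rename_prefs_rel M s s' \<longleftrightarrow> (\<exists>R F.
     s 3 = Leaf \<and> s 4 = Leaf \<and> s 5 = Leaf \<and> s 6 = Leaf \<and> s 7 = enc_prefs R \<and> s 8 = Leaf \<and>
     s 9 = Leaf \<and> s 10 = enc_nats F \<and> s 12 = Leaf \<and> bounded M s \<and> bounded M s' \<and>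
     s' = s(3 := enc_prefs (rev (map (\<lambda>P. rev (map (rev \<circ> map (entries_after F)) P)) R)), 7 := Leaf))"

lemma poly_com_rename_prefs: "poly_com rename_prefs rename_prefs_rel"
  unfolding rename_prefs_def
proof (rule poly_com_mono[OF poly_com_While[OF poly_com_sandwich[OF _ _ poly_com_rename_layer]]])
  let ?pre = "Seq (Assign 8 (Hd (Var 7))) (Assign 7 (Tl (Var 7)))"
  let ?post = "Seq (Assign 3 (Cons (Var 4) (Var 3))) (Assign 4 (Const Leaf))"
  fix M s s'
  assume "rename_prefs_rel M s s'"
  then obtain R F where s: "s 3 = Leaf" "s 4 = Leaf" "s 5 = Leaf" "s 6 = Leaf" "s 7 = enc_prefs R"
      "s 8 = Leaf" "s 9 = Leaf" "s 10 = enc_nats F" "s 12 = Leaf" "bounded M s" "bounded M s'" and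
    s': "s' = s(3 := enc_prefs (rev (map (\<lambda>P. rev (map (rev \<circ> map (entries_after F)) P)) R)), 7 := Leaf)"
    unfolding rename_prefs_rel_def by blast
  let ?S = "\<lambda>xs ys. s(3 := enc_prefs (rev (map (\<lambda>P. rev (map (rev \<circ> map (entries_after F)) P)) xs)),
       7 := enc_prefs ys)"
  have b: "weight enc_layer R < M"
    "weight enc_layer (map (\<lambda>P. rev (map (rev \<circ> map (entries_after F)) P)) R) < M"
    using boundedD[OF s(10), of 7] boundedD[OF s(11), of 3] s(1-9) s' by simp_all
  show "loop_rel 7 (sandwich_rel ?pre rename_layer_rel ?post) M s s'"
  proof (rule loop_rel_listI[where S = ?S and zs = R])
    show "bounded M (?S xs ys)" if "R = xs @ ys" for xs ys
      using b unfolding that by (intro bounded_upd s(10)) auto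
    show "length R \<le> M" using b(1) weight_ge_length[of R enc_layer] by simp
    fix xs y ys
    assume R: "R = xs @ y # ys" and S: "bounded M (?S xs (y # ys))"
    let ?s1 = "(?S xs ys)(8 := enc_layer y)"
    let ?s2 = "?s1(4 := enc_layer (rev (map (rev \<circ> map (entries_after F)) y)), 8 := Leaf)"
    have s1: "bounded M ?s1" and s2: "bounded M ?s2"
      using b unfolding R by (intro bounded_upd s(10); simp)+
    have rel: "rename_layer_rel M ?s1 ?s2"
      unfolding rename_layer_rel_def using s s1 s2
      by (intro exI[of _ y] exI[of _ F]) simp
    have pre: "?s1 = run ?pre (?S xs (y # ys))"
      using s by (auto simp: fun_eq_iff)
    have post: "?S (xs @ [y]) ys = run ?post ?s2"
      using s by (auto simp: fun_eq_iff)
    show "?S xs (y # ys) 7 \<noteq> Leaf \<and>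
        sandwich_rel ?pre rename_layer_rel ?post M (?S xs (y # ys)) (?S (xs @ [y]) ys)"
      by (intro conjI sandwich_relI[where T = rename_layer_rel, OF S pre rel s2 post]) simp
  qed (use s s' in \<open>auto simp: fun_eq_iff\<close>)
qed simp_all

section \<open>The kernel\<close>

text \<open>An absent item gets the index \<open>length xs\<close>, so \<open>index_of_le\<close>
  holds for every item.\<close>

fun index_of :: "'a list \<Rightarrow> 'a \<Rightarrow> nat" where
  "index_of [] x = 0"
| "index_of (y # ys) x = (if y = x then 0 else Suc (index_of ys x))"

lemma index_of_less: "x \<in> set xs \<Longrightarrow> index_of xs x < length xs"
  by (induction xs) auto

lemma nth_index_of: "x \<in> set xs \<Longrightarrow> xs ! index_of xs x = x"
  by (induction xs) auto

lemma inj_on_index_of: "inj_on (index_of xs) (set xs)"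
  by (rule inj_on_inverseI[of _ "(!) xs"]) (rule nth_index_of)

lemma entries_after_rev: "entries_after (rev xs) = index_of xs"
proof
  show "entries_after (rev xs) x = index_of xs x" for x
    by (induction xs) (simp_all add: entries_after_snoc, simp add: entries_after_def)
qed

definition top_prefs :: "goa \<Rightarrow> nat list list list" where
  "top_prefs G = map (map (take (num_agents G))) (prefs G)"

definition top_entries :: "goa \<Rightarrow> nat list" where
  "top_entries G = concat (concat (top_prefs G))"

definition trivial_goa :: goa where
  "trivial_goa = \<lparr>num_agents = 0, num_items = 0, prefs = [[]], alpha = 1\<rparr>"

text \<open>
  Items are renamed to the position of their first occurrence among all truncated lists. This leaves
  some item numbers unused, which does no harm. The case without agents is separate since there
  the size bound is constant, although the number of layers is not.
\<close>

definition goa_kernel :: "goa \<Rightarrow> goa" where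
  "goa_kernel G = (if num_agents G = 0 then trivial_goa else
     \<lparr>num_agents = num_agents G, num_items = length (top_entries G),
      prefs = map (map (map (index_of (top_entries G)))) (top_prefs G), alpha = alpha G\<rparr>)"

lemma set_top_entries:
  assumes "j < num_layers G" "a < length (prefs G ! j)"
  shows "set (take (num_agents G) (prefs G ! j ! a)) \<subseteq> set (top_entries G)"
proof -
  have "prefs G ! j \<in> set (prefs G)" "prefs G ! j ! a \<in> set (prefs G ! j)"
    using assms by (simp_all add: num_layers_def)
  then show ?thesis by (fastforce simp: top_entries_def top_prefs_def)
qed

lemma goa_instanceD:
  assumes "goa_instance G" "j < num_layers G"
  shows "length (prefs G ! j) = num_agents G"
    and "a \<in> agents G \<Longrightarrow> distinct (prefs G ! j ! a)"
    and "a \<in> agents G \<Longrightarrow> set (prefs G ! j ! a) \<subseteq> items G"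
proof -
  have "prefs G ! j \<in> set (prefs G)" using assms(2) by (simp add: num_layers_def)
  then show "length (prefs G ! j) = num_agents G"
    and "a \<in> agents G \<Longrightarrow> distinct (prefs G ! j ! a)"
    and "a \<in> agents G \<Longrightarrow> set (prefs G ! j ! a) \<subseteq> items G"
    using assms(1) by (auto simp: goa_instance_def agents_def)
qed

lemma top_entries_items:
  assumes "goa_instance G"
  shows "set (top_entries G) \<subseteq> items G"
proof
  fix x assume "x \<in> set (top_entries G)"
  then obtain P L where "P \<in> set (prefs G)" "L \<in> set P" "x \<in> set L"
    by (auto simp: top_entries_def top_prefs_def dest: in_set_takeD)
  then show "x \<in> items G" using assms by (auto simp: goa_instance_def)
qed

text \<open>Without agents nobody can improve, so any \<open>alpha G\<close> layers serve, here the
  first ones.\<close>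

lemma goa_yes_no_agents:
  assumes "goa_instance G" "num_agents G = 0"
  shows "goa_yes G"
proof -
  have "globally_optimal G (\<lambda>_. None)"
    unfolding globally_optimal_def using assms
    by (auto intro!: exI[of _ "{..<alpha G}"]
        simp: agents_def assignment_def pareto_optimal_def legal_def goa_instance_def)
  then show ?thesis by (auto simp: goa_yes_def)
qed

lemma goa_instance_kernel:
  assumes "goa_instance G"
  shows "goa_instance (goa_kernel G)"
proof (cases "num_agents G = 0")
  case False
  have L: "distinct (map (index_of (top_entries G)) (take (num_agents G) L))"
     "set (map (index_of (top_entries G)) (take (num_agents G) L)) \<subseteq> {..<length (top_entries G)}"
    if "P \<in> set (prefs G)" "L \<in> set P" for P L
  proof -
    have sub: "set (take (num_agents G) L) \<subseteq> set (top_entries G)"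
      using that by (force simp: top_entries_def top_prefs_def)
    then show "distinct (map (index_of (top_entries G)) (take (num_agents G) L))"
      using assms that inj_on_subset[OF inj_on_index_of]
      by (auto simp: distinct_map goa_instance_def)
    show "set (map (index_of (top_entries G)) (take (num_agents G) L)) \<subseteq> {..<length (top_entries G)}"
      using sub index_of_less by fastforce
  qed
  from False show ?thesis
    using assms L unfolding goa_instance_def goa_kernel_def
    by (auto simp: top_prefs_def num_layers_def items_def)
qed (simp add: goa_kernel_def trivial_goa_def goa_instance_def num_layers_def)

text \<open>The set \<open>S\<close> of layers stays the same. Truncation keeps the assignment, and
  renaming composes it with \<open>index_of\<close> or with its inverse on the retained
  items.\<close>

lemma goa_yes_kernel:
  assumes G: "goa_instance G"
  shows "goa_yes (goa_kernel G) \<longleftrightarrow> goa_yes G"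
proof (cases "num_agents G = 0")
  case True
  then have "goa_yes (goa_kernel G)"
    using goa_instance_kernel[OF G] by (intro goa_yes_no_agents) (auto simp: goa_kernel_def trivial_goa_def)
  with True G show ?thesis using goa_yes_no_agents by blast
next
  case False
  let ?A = "agents G" and ?I = "items G" and ?U = "set (top_entries G)" and ?r = "index_of (top_entries G)"
  let ?I' = "{..<length (top_entries G)}"
  let ?T = "\<lambda>j a. take (num_agents G) (prefs G ! j ! a)"
  have K: "agents (goa_kernel G) = ?A" "items (goa_kernel G) = ?I'" "num_layers (goa_kernel G) = num_layers G"
    "alpha (goa_kernel G) = alpha G"
    using False by (simp_all add: goa_kernel_def agents_def items_def num_layers_def top_prefs_def)
  have KP: "prefs (goa_kernel G) ! j ! a = map ?r (?T j a)" if "j < num_layers G" "a \<in> ?A" for j a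
    using that False goa_instanceD(1)[OF G that(1)]
    by (simp add: goa_kernel_def agents_def num_layers_def top_prefs_def)
  have TU: "set (?T j a) \<subseteq> ?U" if "j < num_layers G" "a \<in> ?A" for j a
    using set_top_entries[of j G a] that goa_instanceD(1)[OF G that(1)] by (simp add: agents_def)
  have inj: "inj_on ?r ?U" by (rule inj_on_index_of)
  have rU: "?r ` ?U \<subseteq> ?I'" using index_of_less by fastforce
  have UI: "?U \<subseteq> ?I" using top_entries_items[OF G] .
  have trunc: "pareto_optimal ?A ?I (?T j) p \<longleftrightarrow> pareto_optimal ?A ?I (\<lambda>a. prefs G ! j ! a) p"
    if "j < num_layers G" for j p
    using pareto_optimal_take[of ?A "\<lambda>a. prefs G ! j ! a" ?I p] goa_instanceD[OF G that]
    by (simp add: agents_def)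
  have alpha: "0 < alpha G" using G by (simp add: goa_instance_def)
  show ?thesis
  proof
    assume "goa_yes G"
    then obtain p S where p: "assignment ?A ?I p" "S \<subseteq> {..<num_layers G}" "card S = alpha G"
      "\<And>j. j \<in> S \<Longrightarrow> pareto_optimal ?A ?I (\<lambda>a. prefs G ! j ! a) p"
      by (auto simp: goa_yes_def globally_optimal_def)
    let ?p = "\<lambda>a. map_option ?r (p a)"
    have opt: "pareto_optimal ?A ?I' (\<lambda>a. prefs (goa_kernel G) ! j ! a) ?p" if "j \<in> S" for j
    proof -
      have j: "j < num_layers G" using that p(2) by auto
      have "pareto_optimal ?A ?I' (\<lambda>a. map ?r (?T j a)) ?p"
        by (rule pareto_optimal_rename[OF _ inj rU UI TU[OF j]]) (use p(4)[OF that] trunc[OF j] in simp)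
      also have "?this \<longleftrightarrow> ?thesis" using KP[OF j] by (intro pareto_optimal_cong) auto
      finally show ?thesis .
    qed
    \<comment> \<open>Outside \<open>?U\<close> the map \<open>?r\<close> need not be injective, so
      \<open>assignment ?A ?I p\<close> alone does not carry over. Legality of \<open>?p\<close> in
      one layer of \<open>S\<close> does the job, and \<open>S\<close> is nonempty as
      \<open>alpha G\<close> is positive.\<close>
    moreover obtain j where "j \<in> S" using p(3) alpha by (metis card.empty ex_in_conv less_irrefl)
    ultimately have "assignment ?A ?I' ?p" by (auto simp: pareto_optimal_def legal_def)
    with opt p(2,3) show "goa_yes (goa_kernel G)"
      unfolding goa_yes_def globally_optimal_def K by blast
  next
    assume "goa_yes (goa_kernel G)"
    then obtain p S where p: "assignment ?A ?I' p" "S \<subseteq> {..<num_layers G}" "card S = alpha G"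
      "\<And>j. j \<in> S \<Longrightarrow> pareto_optimal ?A ?I' (\<lambda>a. prefs (goa_kernel G) ! j ! a) p"
      unfolding goa_yes_def globally_optimal_def K by blast
    let ?r' = "inv_into ?U ?r"
    let ?p = "\<lambda>a. map_option ?r' (p a)"
    have opt: "pareto_optimal ?A ?I (\<lambda>a. prefs G ! j ! a) ?p" if "j \<in> S" for j
    proof -
      have j: "j < num_layers G" using that p(2) by auto
      have "pareto_optimal ?A ?I' (\<lambda>a. map ?r (?T j a)) p \<longleftrightarrow>
          pareto_optimal ?A ?I' (\<lambda>a. prefs (goa_kernel G) ! j ! a) p"
        using KP[OF j] by (intro pareto_optimal_cong) auto
      then have opt': "pareto_optimal ?A ?I' (\<lambda>a. map ?r (?T j a)) p" using p(4)[OF that] by simp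
      have "pareto_optimal ?A ?I (\<lambda>a. map ?r' (map ?r (?T j a))) ?p"
      proof (rule pareto_optimal_rename[OF opt'])
        show "inj_on ?r' (?r ` ?U)" by (rule inj_on_inv_into) simp
        show "?r' ` ?r ` ?U \<subseteq> ?I" using inj UI by (simp add: image_image)
        show "?r ` ?U \<subseteq> ?I'" by (rule rU)
        show "set (map ?r (?T j a)) \<subseteq> ?r ` ?U" if "a \<in> ?A" for a
          using TU[OF j that] by auto
      qed
      also have "?this \<longleftrightarrow> pareto_optimal ?A ?I (?T j) ?p"
        using map_inv_into_rename[OF inj TU[OF j]] by (intro pareto_optimal_cong) auto
      finally show ?thesis using trunc[OF j] by simp
    qed
    moreover obtain j where "j \<in> S" using p(3) alpha by (metis card.empty ex_in_conv less_irrefl)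
    ultimately have "assignment ?A ?I ?p" by (auto simp: pareto_optimal_def legal_def)
    with opt p(2,3) show "goa_yes G"
      unfolding goa_yes_def globally_optimal_def by blast
  qed
qed

section \<open>Running time of the whole program\<close>

definition kernel_com :: com where
  "kernel_com = Seq (Seq (Assign 1 (Hd (Var 0))) (Assign 3 (Tl (Tl (Tl (Var 0))))))
     (If (Var 1)
       (Seq trunc_prefs
       (Seq rename_prefs
         (Assign 0 (Cons (Var 1) (Cons (Var 11) (Cons (Hd (Tl (Tl (Var 0)))) (Var 3)))))))
       (Assign 0 (Const (enc_goa trivial_goa))))"

text \<open>The factor scales the contents, and \<open>1 \<le> c\<close> lets it cover the node of
  each cell as well. Truncation uses \<open>c = 1\<close>, renaming uses the input size.\<close>

lemma weight_map_le:
  assumes "\<And>x. x \<in> set xs \<Longrightarrow> tree_size (f (h x)) \<le> c * tree_size (g x)" "1 \<le> c"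
  shows "weight f (map h xs) \<le> c * weight g xs"
  using assms(1)
proof (induction xs)
  case (Cons x xs)
  then have "tree_size (f (h x)) \<le> c * tree_size (g x)" "weight f (map h xs) \<le> c * weight g xs"
    by simp_all
  then show ?case using assms(2) by (simp add: distrib_left)
qed simp

lemma tree_size_enc_list_map_le:
  assumes "\<And>x. x \<in> set xs \<Longrightarrow> tree_size (f (h x)) \<le> c * tree_size (g x)" "1 \<le> c"
  shows "tree_size (enc_list f (map h xs)) \<le> c * tree_size (enc_list g xs)"
  using weight_map_le[of xs f h c g] assms by simp

lemma weight_concat: "weight f (concat xss) \<le> weight (enc_list f) xss"
  by (induction xss) simp_all

lemma index_of_le: "index_of xs x \<le> length xs"
  by (induction xs) simp_all

lemma poly_time_kernel: "poly_time_on {G. goa_instance G} enc_goa enc_goa goa_kernel"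
proof -
  have straight: "straight (Seq (Assign 1 (Hd (Var 0))) (Assign 3 (Tl (Tl (Tl (Var 0))))))"
    "straight (Assign 0 (Cons (Var 1) (Cons (Var 11) (Cons (Hd (Tl (Tl (Var 0)))) (Var 3)))))"
    "straight (Assign 0 (Const (enc_goa trivial_goa)))" by simp_all
  \<comment> \<open>The polynomial is fixed before any instance, as \<open>poly_time_on\<close>
    demands. The premises spell out the relations composed by the rules for \<open>Seq\<close> and
    \<open>If\<close>.\<close>
  obtain b :: "nat poly" where b: "\<And>M s1 s2. bounded M s1 \<Longrightarrow>
      s2 = run (Seq (Assign 1 (Hd (Var 0))) (Assign 3 (Tl (Tl (Tl (Var 0)))))) s1 \<Longrightarrow> bounded M s2 \<Longrightarrow>
      (if s2 1 \<noteq> Leaf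
       then \<exists>s3. trunc_prefs_rel M s2 s3 \<and> (\<exists>s4. rename_prefs_rel M s3 s4 \<and> bounded M s4 \<and>
         s' = run (Assign 0 (Cons (Var 1) (Cons (Var 11) (Cons (Hd (Tl (Tl (Var 0)))) (Var 3))))) s4)
       else bounded M s2 \<and> s' = run (Assign 0 (Const (enc_goa trivial_goa))) s2) \<Longrightarrow>
      \<exists>t \<le> poly b M. exec kernel_com s1 t s'" for s'
    using poly_com_Seq[OF poly_com_straight[OF straight(1)] poly_com_If[where x = 1,
      OF poly_com_Seq[OF poly_com_trunc_prefs poly_com_Seq[OF poly_com_rename_prefs
        poly_com_straight[OF straight(2)]]] poly_com_straight[OF straight(3)]]]
    unfolding poly_com_def kernel_com_def[symmetric] by blast
  have "\<exists>t s. exec kernel_com ((\<lambda>_. Leaf)(0 := enc_goa G)) t s \<and> s 0 = enc_goa (goa_kernel G) \<and>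
      t \<le> poly (pcompose b ([:0, 1:] * [:0, 1:])) (tree_size (enc_goa G))"
    if G: "goa_instance G" for G
  proof -
    define N where "N = tree_size (enc_goa G)"
    \<comment> \<open>Renaming may replace a small number by a large index, so the output can exceed
      \<open>N\<close>; no entry grows by more than the factor \<open>N\<close>.\<close>
    define M where "M = N * N"
    let ?n = "num_agents G" and ?R = "prefs G" and ?r = "index_of (top_entries G)"
    let ?F = "rev (top_entries G)"
    let ?R' = "rev (map (\<lambda>P. rev (map (rev \<circ> take ?n) P)) ?R)"
    let ?K = "map (map (map ?r)) (top_prefs G)"
    let ?s1 = "(\<lambda>_. Leaf)(0 := enc_goa G) :: state"
    let ?s2 = "?s1(1 := enc_nat ?n, 3 := enc_prefs ?R)"
    let ?s3 = "?s2(3 := Leaf, 7 := enc_prefs ?R', 10 := enc_nats ?F, 11 := enc_nat (length ?F))"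
    let ?s4 = "?s3(3 := enc_prefs ?K, 7 := Leaf)"
    have N: "tree_size (enc_nat ?n) \<le> N" "tree_size (enc_prefs ?R) \<le> N" "1 \<le> N"
      by (simp_all add: N_def enc_goa_def)
    have "N \<le> M" using N(3) by (simp add: M_def)
    have R': "weight enc_layer ?R' \<le> 1 * weight enc_layer ?R"
      unfolding weight_rev
    proof (rule weight_map_le)
      have "weight enc_nats (map (rev \<circ> take ?n) P) \<le> 1 * weight enc_nats P" for P
        by (rule weight_map_le) (simp_all add: weight_take)
      then show "tree_size (enc_layer (rev (map (rev \<circ> take ?n) P))) \<le> 1 * tree_size (enc_layer P)" for P
        by simp
    qed simp
    have top: "weight enc_layer (top_prefs G) \<le> 1 * weight enc_layer ?R"
      unfolding top_prefs_def
    proof (rule weight_map_le)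
      show "tree_size (enc_layer (map (take ?n) P)) \<le> 1 * tree_size (enc_layer P)" for P
        by (rule tree_size_enc_list_map_le) (simp_all add: weight_take)
    qed simp
    have F: "weight enc_nat ?F \<le> weight enc_layer ?R"
      using weight_concat[of enc_nat "concat (top_prefs G)"] weight_concat[of enc_nats "top_prefs G"] top
      by (simp add: top_entries_def)
    \<comment> \<open>As a multiple of the old entry size, the bound passes through all three list
      levels by \<open>tree_size_enc_list_map_le\<close>.\<close>
    have r: "tree_size (enc_nat (?r x)) \<le> N * tree_size (enc_nat x)" for x
    proof -
      have "tree_size (enc_nat (?r x)) \<le> N"
        using index_of_le[of "top_entries G" x] weight_ge_length[of ?F enc_nat] F N(2) by simp
      also have "\<dots> \<le> N * tree_size (enc_nat x)" by simp
      finally show ?thesis .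
    qed
    have "tree_size (enc_prefs ?K) \<le> N * tree_size (enc_prefs (top_prefs G))"
      using N(3) r by (intro tree_size_enc_list_map_le)
    also have "\<dots> \<le> M" unfolding M_def using top N(2) by (intro mult_le_mono2) simp
    finally have K: "tree_size (enc_prefs ?K) \<le> M" .
    have s1: "bounded M ?s1" using \<open>N \<le> M\<close> N(3) by (auto simp: bounded_def N_def simp del: One_nat_def)
    have s2: "bounded M ?s2" using N \<open>N \<le> M\<close> by (intro bounded_upd s1) simp_all
    have s3: "bounded M ?s3"
      using N(2,3) R' F weight_ge_length[of ?F enc_nat] \<open>N \<le> M\<close> by (intro bounded_upd s2) simp_all
    have s4: "bounded M ?s4" using K N(3) \<open>N \<le> M\<close> by (intro bounded_upd s3) simp_all
    have pre: "?s2 = run (Seq (Assign 1 (Hd (Var 0))) (Assign 3 (Tl (Tl (Tl (Var 0)))))) ?s1"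
      by (auto simp: fun_eq_iff enc_goa_def)
    show ?thesis
    proof (cases "?n = 0")
      case True
      let ?s' = "run (Assign 0 (Const (enc_goa trivial_goa))) ?s2"
      have "if ?s2 1 \<noteq> Leaf then P else bounded M ?s2 \<and> ?s' = ?s'" for P
        using True s2 by simp
      from b[OF s1 pre s2 this] obtain t where "t \<le> poly b M" "exec kernel_com ?s1 t ?s'" by blast
      with True show ?thesis
        by (intro exI[of _ t] exI[of _ ?s']) (simp add: goa_kernel_def poly_pcompose M_def N_def)
    next
      case False
      \<comment> \<open>Variable 0 has kept the input throughout, so \<alpha> is still available
        there.\<close>
      let ?s' = "run (Assign 0 (Cons (Var 1) (Cons (Var 11) (Cons (Hd (Tl (Tl (Var 0)))) (Var 3))))) ?s4"
      have "concat (map (concat \<circ> map f) Rs) = concat (concat (map (map f) Rs))"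
        for f :: "nat list \<Rightarrow> nat list" and Rs
        by (induction Rs) simp_all
      then have "concat (map (concat \<circ> map (take ?n)) ?R) = top_entries G"
        by (simp add: top_entries_def top_prefs_def)
      then have trunc: "trunc_prefs_rel M ?s2 ?s3"
        unfolding trunc_prefs_rel_def using s2 s3
        by (intro exI[of _ ?R] exI[of _ ?n] exI[of _ "[]"]) simp
      have "rev (map (\<lambda>P. rev (map (rev \<circ> map (entries_after ?F)) P)) ?R') = ?K"
        by (simp add: rev_map entries_after_rev top_prefs_def comp_def)
      then have rename: "rename_prefs_rel M ?s3 ?s4"
        unfolding rename_prefs_rel_def using s3 s4
        by (intro exI[of _ ?R'] exI[of _ ?F]) simp
      have n: "?s2 1 \<noteq> Leaf" using False by simp
      have "if ?s2 1 \<noteq> Leaf then \<exists>s3. trunc_prefs_rel M ?s2 s3 \<and>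
          (\<exists>s4. rename_prefs_rel M s3 s4 \<and> bounded M s4 \<and>
          ?s' = run (Assign 0 (Cons (Var 1) (Cons (Var 11) (Cons (Hd (Tl (Tl (Var 0)))) (Var 3))))) s4)
        else P" for P
        unfolding if_P[OF n] using trunc rename s4 by blast
      from b[OF s1 pre s2 this] obtain t where "t \<le> poly b M" "exec kernel_com ?s1 t ?s'" by blast
      with False show ?thesis
        by (intro exI[of _ t] exI[of _ ?s']) (simp add: goa_kernel_def enc_goa_def poly_pcompose M_def N_def)
    qed
  qed
  then show ?thesis unfolding poly_time_on_def by blast
qed

lemma goa_kernelization_kernel: "goa_kernelization goa_kernel"
  using poly_time_kernel goa_instance_kernel goa_yes_kernel by (simp add: goa_kernelization_def)

section \<open>Size bounds for the kernel\<close>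

lemma sum_list_le_length_mult:
  "(\<And>x. x \<in> set xs \<Longrightarrow> f x \<le> (k :: nat)) \<Longrightarrow> (\<Sum>x\<leftarrow>xs. f x) \<le> length xs * k"
proof (induction xs)
  case (Cons x xs)
  then show ?case using add_mono[of "f x" k] by simp
qed simp

lemma length_top_entries:
  assumes "goa_instance G"
  shows "length (top_entries G) \<le> num_layers G * num_agents G ^ 2"
proof -
  let ?n = "num_agents G"
  have "(\<Sum>L\<leftarrow>P. length (take ?n L)) \<le> ?n * ?n" if "P \<in> set (prefs G)" for P
    using sum_list_le_length_mult[of P "\<lambda>L. length (take ?n L)" ?n] assms that
    by (simp add: goa_instance_def)
  then have "(\<Sum>P\<leftarrow>prefs G. \<Sum>L\<leftarrow>P. length (take ?n L)) \<le> length (prefs G) * (?n * ?n)"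
    by (rule sum_list_le_length_mult)
  moreover have "length (concat (concat xsss)) = (\<Sum>xss\<leftarrow>xsss. \<Sum>xs\<leftarrow>xss. length xs)"
    for xsss :: "nat list list list"
    by (induction xsss) (simp_all add: length_concat)
  ultimately show ?thesis
    by (simp add: top_entries_def top_prefs_def num_layers_def power2_eq_square comp_def)
qed

text \<open>With an agent present, the size is at most a sum of six terms, each at most l n^2:
  agents, items, \<alpha>, and l, l n, l n^2 for the lists. The additive 6 covers
  \<open>trivial_goa\<close>, of size 2.\<close>

lemma goa_size_kernel:
  assumes G: "goa_instance G"
  shows "goa_size (goa_kernel G) \<le> 6 * (num_layers G * num_agents G ^ 2) + 6"
proof (cases "num_agents G = 0")
  case True
  then show ?thesis by (simp add: goa_kernel_def trivial_goa_def goa_size_def)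
next
  case False
  let ?n = "num_agents G" and ?l = "num_layers G"
  have l: "1 \<le> ?l" "alpha G \<le> ?l" using G by (auto simp: goa_instance_def)
  have "(\<Sum>L\<leftarrow>P. 1 + length (take ?n L)) \<le> ?n * (1 + ?n)" if "P \<in> set (prefs G)" for P
    using sum_list_le_length_mult[of P "\<lambda>L. 1 + length (take ?n L)" "1 + ?n"] G that
    by (simp add: goa_instance_def)
  then have "(\<Sum>P\<leftarrow>prefs G. 1 + (\<Sum>L\<leftarrow>P. 1 + length (take ?n L))) \<le> ?l * (1 + ?n * (1 + ?n))"
    unfolding num_layers_def by (intro sum_list_le_length_mult add_left_mono)
  moreover have "goa_size (goa_kernel G) = ?n + length (top_entries G) + alpha G +
      (\<Sum>P\<leftarrow>prefs G. 1 + (\<Sum>L\<leftarrow>P. 1 + length (take ?n L)))"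
    using False by (simp add: goa_size_def goa_kernel_def top_prefs_def comp_def)
  moreover have "?n \<le> ?l * ?n ^ 2" "?l \<le> ?l * ?n ^ 2" "?l * ?n \<le> ?l * ?n ^ 2"
    using l(1) False by (simp_all add: power2_eq_square)
  moreover have "?l * (1 + ?n * (1 + ?n)) = ?l + ?l * ?n + ?l * ?n ^ 2"
    by (simp add: distrib_left power2_eq_square)
  ultimately show ?thesis
    using length_top_entries[OF G] l(2) by linarith
qed

text \<open>An entry has an index of at most \<open>k ^ 3\<close>, so with its cell it costs at most
  \<open>2 + 2 * k ^ 3\<close>; each nesting level multiplies by at most \<open>k\<close> and adds 2
  per cell. The constant 11 is the encoded size of \<open>trivial_goa\<close> and exceeds the 7
  fixed nodes of the other case.\<close>

lemma tree_size_kernel: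
  assumes G: "goa_instance G"
  defines "k \<equiv> num_agents G + num_layers G"
  shows "tree_size (enc_goa (goa_kernel G)) \<le> 11 + 4 * k + 2 * k ^ 3 + k * (2 + k * (2 + k * (2 + 2 * k ^ 3)))"
proof (cases "num_agents G = 0")
  case True
  then show ?thesis by (simp add: goa_kernel_def trivial_goa_def enc_goa_def numeral_eq_Suc)
next
  case False
  let ?n = "num_agents G" and ?l = "num_layers G" and ?r = "index_of (top_entries G)"
  let ?w = "\<lambda>L. map ?r (take ?n L)"
  have k: "?n \<le> k" "?l \<le> k" "alpha G \<le> k" using G by (auto simp: k_def goa_instance_def)
  have "?l * ?n ^ 2 \<le> k * k ^ 2" using k by (intro mult_le_mono power_mono) auto
  then have len: "length (top_entries G) \<le> k ^ 3"
    using length_top_entries[OF G] by (simp add: power3_eq_cube power2_eq_square)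
  have "weight enc_nat (?w L) \<le> k * (2 + 2 * k ^ 3)" for L
  proof -
    have "weight enc_nat (?w L) \<le> length (?w L) * (2 + 2 * k ^ 3)"
      unfolding weight_def using index_of_le[of "top_entries G"] len
      by (intro sum_list_le_length_mult) (auto intro: order_trans)
    also have "\<dots> \<le> k * (2 + 2 * k ^ 3)" using k by (intro mult_le_mono1) simp
    finally show ?thesis .
  qed
  then have "weight enc_nats (map ?w P) \<le> k * (2 + k * (2 + 2 * k ^ 3))" if "P \<in> set (prefs G)" for P
  proof -
    have "weight enc_nats (map ?w P) \<le> length (map ?w P) * (2 + k * (2 + 2 * k ^ 3))"
      unfolding weight_def using \<open>\<And>L. weight enc_nat (?w L) \<le> _\<close>
      by (intro sum_list_le_length_mult) auto
    also have "\<dots> \<le> k * (2 + k * (2 + 2 * k ^ 3))"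
      using k G that by (intro mult_le_mono1) (simp add: goa_instance_def)
    finally show ?thesis .
  qed
  then have "weight enc_layer (map (map ?w) (prefs G)) \<le>
      length (map (map ?w) (prefs G)) * (2 + k * (2 + k * (2 + 2 * k ^ 3)))"
    unfolding weight_def[of enc_layer] by (intro sum_list_le_length_mult) auto
  also have "\<dots> \<le> k * (2 + k * (2 + k * (2 + 2 * k ^ 3)))"
    using k by (intro mult_le_mono1) (simp add: num_layers_def)
  finally show ?thesis
    using False len k by (simp add: goa_kernel_def enc_goa_def top_prefs_def comp_def)
qed

theorem theorem2:
  "goa_kernel_of_size (\<lambda>G. num_layers G * num_agents G ^ 2) \<and>
   goa_polynomial_kernel (\<lambda>G. num_agents G + num_layers G)"
proof
  show "goa_kernel_of_size (\<lambda>G. num_layers G * num_agents G ^ 2)"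
    unfolding goa_kernel_of_size_def using goa_kernelization_kernel goa_size_kernel by blast
  let ?X = "[:0, 1:] :: nat poly"
  let ?b = "11 + 4 * ?X + 2 * ?X ^ 3 + ?X * (2 + ?X * (2 + ?X * (2 + 2 * ?X ^ 3)))"
  have b: "poly ?b k = 11 + 4 * k + 2 * k ^ 3 + k * (2 + k * (2 + k * (2 + 2 * k ^ 3)))" for k
    by (simp only: poly_add poly_mult poly_power poly_numeral poly_pCons poly_0) simp
  \<comment> \<open>The parameter can only grow when \<open>trivial_goa\<close> is returned, whose
    single layer is covered by the constant term of \<open>?b\<close>.\<close>
  have "num_agents (goa_kernel G) + num_layers (goa_kernel G) \<le> 11 + (num_agents G + num_layers G)" for G
    by (simp add: goa_kernel_def trivial_goa_def num_layers_def top_prefs_def)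
  then have "num_agents (goa_kernel G) + num_layers (goa_kernel G) \<le> poly ?b (num_agents G + num_layers G)" for G
    unfolding b by (rule order_trans) simp
  then show "goa_polynomial_kernel (\<lambda>G. num_agents G + num_layers G)"
    unfolding goa_polynomial_kernel_def
    using goa_kernelization_kernel tree_size_kernel b by (intro exI[of _ goa_kernel] exI[of _ ?b]) simp
qed

end
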